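(* Let $X$ be a compact metrizable space, $T:X\to X$ a homeomorphism, and $d\in\mathbb N$. If $\mathrm{Mult}(T)=d$, then there is an affine embedding of $(\mathcal M(X),T_* )$ in $(([0,1]^d)^{\mathbb Z},\sigma_d)$. Conversely, if $(\mathcal M(X),T_* )$ embeds affinely into $(([0,1]^d)^{\mathbb Z},\sigma_d)$, then - either $\sharp\mathcal M_e(X,T)\leq d$ and $\mathrm{Mult}(T)\leq d$, - or $\sharp\mathcal M_e(X,T)=d+1$ and $\mathrm{Mult}(T)=d+1$.
   Context: $\mathcal M(X)$ is the compact convex set of Borel probability measures on $X$ with the weak-$*$ topology, and $T_*:\mathcal M(X)\to\mathcal M(X)$ is $T_*\mu(\cdot)=\mu(T^{-1}\cdot)$. $\mathcal M_e(X,T)$ is the set of ergodic $T$-invariant Borel probability measures and $\sharp$ denotes cardinality. $\sigma_d$ is the shift on $([0,1]^d)^{\mathbb Z}$, $(\sigma_d x)_n=x_{n+1}$. An affine embedding of $(\mathcal M(X),T_* )$ in $(([0,1]^d)^{\mathbb Z},\sigma_d)$ is a continuous injective affine map $\phi:\mathcal M(X)\to([0,1]^d)^{\mathbb Z}$ with $\phi\circ T_*=\sigma_d\circ\phi$. The topological multiplicity $\mathrm{Mult}(T)\in\mathbb N\cup\{\infty\}$ is the smallest cardinality of a set $F\subset C(X)$ such that the linear span of $\{f\circ T^n: f\in F,\ n\in\mathbb Z\}$ is dense in the Banach space $C(X)$ of real continuous functions with the supremum norm. *)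

theory Defs
  imports "HOL-Probability.Probability"
begin

text \<open>
  The space \<open>X\<close> is the universe of a topological type. When it is compact,
  \<^typ>\<open>'a \<Rightarrow>\<^sub>C real\<close> (bounded continuous functions, supremum norm) is the Banach
  space \<open>C(X)\<close>.
\<close>

definition borel_probs :: "'a::topological_space measure set" where
  "borel_probs = {\<mu>. prob_space \<mu> \<and> sets \<mu> = sets borel}"

text \<open>The coarsest topology on the Borel probability measures for which all evaluations
  \<open>\<mu> \<mapsto> \<integral>f d\<mu>\<close>, with \<open>f\<close> continuous, are continuous.\<close>

definition weak_star_topology :: "'a::topological_space measure topology" where
  "weak_star_topology =
     pullback_topology borel_probs
       (\<lambda>\<mu> (f :: 'a \<Rightarrow>\<^sub>C real). integral\<^sup>L \<mu> (apply_bcontfun f))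
       (product_topology (\<lambda>_. euclideanreal) UNIV)"

text \<open>The mixture \<open>t\<mu> + (1 - t)\<nu>\<close>; see \<open>emeasure_mixture\<close> below.\<close>

definition mixture ::
    "real \<Rightarrow> 'a::topological_space measure \<Rightarrow> 'a measure \<Rightarrow> 'a measure" where
  "mixture t \<mu> \<nu> = measure_of UNIV (sets borel)
     (\<lambda>A. ennreal t * emeasure \<mu> A + ennreal (1 - t) * emeasure \<nu> A)"

definition push :: "('a::topological_space \<Rightarrow> 'a) \<Rightarrow> 'a measure \<Rightarrow> 'a measure" where
  "push T \<mu> = distr \<mu> borel T"

definition ergodic_probs :: "('a::topological_space \<Rightarrow> 'a) \<Rightarrow> 'a measure set" where
  "ergodic_probs T = {\<mu> \<in> borel_probs. push T \<mu> = \<mu> \<and>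
     (\<forall>A\<in>sets borel. T -` A = A \<longrightarrow> measure \<mu> A = 0 \<or> measure \<mu> A = 1)}"

definition ecard :: "'b set \<Rightarrow> enat" where
  "ecard F = (if finite F then enat (card F) else \<infinity>)"

definition iterate_int :: "('a \<Rightarrow> 'a) \<Rightarrow> int \<Rightarrow> 'a \<Rightarrow> 'a" where
  "iterate_int T n = (if n \<ge> 0 then T ^^ nat n else inv T ^^ nat (- n))"

definition translates ::
    "('a::topological_space \<Rightarrow> 'a) \<Rightarrow> ('a \<Rightarrow>\<^sub>C real) set \<Rightarrow> ('a \<Rightarrow>\<^sub>C real) set" where
  "translates T F =
     {g. \<exists>f\<in>F. \<exists>n. apply_bcontfun g = apply_bcontfun f \<circ> iterate_int T n}"

definition Mult :: "('a::topological_space \<Rightarrow> 'a) \<Rightarrow> enat" where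
  "Mult T = (INF F \<in> {F. closure (span (translates T F)) = UNIV}. ecard F)"

text \<open>Points of \<open>[0,1]\<^sup>d\<close> are functions on \<open>{..<d}\<close>, extended by \<^const>\<open>undefined\<close>.\<close>

definition cube_sequences :: "nat \<Rightarrow> (int \<Rightarrow> nat \<Rightarrow> real) topology" where
  "cube_sequences d =
     product_topology (\<lambda>_. product_topology (\<lambda>_. top_of_set {0..1}) {..<d}) UNIV"

definition shift :: "(int \<Rightarrow> 'b) \<Rightarrow> int \<Rightarrow> 'b" where
  "shift x = (\<lambda>n. x (n + 1))"

definition affine_embedding ::
    "('a::topological_space \<Rightarrow> 'a) \<Rightarrow> nat \<Rightarrow> ('a measure \<Rightarrow> int \<Rightarrow> nat \<Rightarrow> real) \<Rightarrow> bool" where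
  "affine_embedding T d \<phi> \<longleftrightarrow>
     continuous_map weak_star_topology (cube_sequences d) \<phi> \<and>
     inj_on \<phi> borel_probs \<and>
     (\<forall>\<mu>\<in>borel_probs. \<forall>\<nu>\<in>borel_probs. \<forall>t\<in>{0..1}. \<forall>n. \<forall>i<d.
        \<phi> (mixture t \<mu> \<nu>) n i = t * \<phi> \<mu> n i + (1 - t) * \<phi> \<nu> n i) \<and>
     (\<forall>\<mu>\<in>borel_probs. \<phi> (push T \<mu>) = shift (\<phi> \<mu>))"

lemma topspace_weak_star_topology: "topspace weak_star_topology = borel_probs"
  by (simp add: weak_star_topology_def topspace_pullback_topology)

lemma sets_mixture [simp]: "sets (mixture t \<mu> \<nu>) = sets borel"
  unfolding mixture_def by (metis sets.sets_measure_of_eq space_borel)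

lemma emeasure_mixture:
  assumes \<mu>: "\<mu> \<in> borel_probs" and \<nu>: "\<nu> \<in> borel_probs" and A: "A \<in> sets borel"
  shows "emeasure (mixture t \<mu> \<nu>) A =
    ennreal t * emeasure \<mu> A + ennreal (1 - t) * emeasure \<nu> A"
proof -
  have s: "sets \<mu> = sets borel" "sets \<nu> = sets borel"
    using \<mu> \<nu> by (auto simp: borel_probs_def)
  let ?m = "\<lambda>A. ennreal t * emeasure \<mu> A + ennreal (1 - t) * emeasure \<nu> A"
  have "countably_additive (sets borel) ?m"
    unfolding countably_additive_def
    by (auto simp: s suminf_add[symmetric] ennreal_suminf_cmult suminf_emeasure)
  moreover have "positive (sets borel) ?m"
    by (simp add: positive_def)
  ultimately show ?thesis
    unfolding mixture_def
    by (intro emeasure_measure_of_sigma)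
       (use A sets.sigma_algebra_axioms[of borel] in auto)
qed

lemma mixture_in_borel_probs:
  assumes "\<mu> \<in> borel_probs" "\<nu> \<in> borel_probs" "0 \<le> t" "t \<le> 1"
  shows "mixture t \<mu> \<nu> \<in> borel_probs"
proof -
  have "space (mixture t \<mu> \<nu>) = UNIV" "space \<mu> = UNIV" "space \<nu> = UNIV"
    using assms(1,2) sets_eq_imp_space_eq[OF sets_mixture[of t \<mu> \<nu>]]
    by (auto simp: borel_probs_def dest!: sets_eq_imp_space_eq)
  moreover have "emeasure \<mu> (space \<mu>) = 1" "emeasure \<nu> (space \<nu>) = 1"
    using assms(1,2) by (auto simp: borel_probs_def prob_space.emeasure_space_1)
  ultimately have "emeasure (mixture t \<mu> \<nu>) (space (mixture t \<mu> \<nu>)) = 1"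
    using assms by (simp add: emeasure_mixture ennreal_plus[symmetric] del: ennreal_plus)
  then show ?thesis
    by (simp add: borel_probs_def prob_spaceI)
qed

end

theory Submission
  imports Defs
begin

text \<open>
  A dense set of observables separates probability measures, which gives the embedding by integrating
  the translates of the generators. Conversely, the coordinates of an affine embedding at time \<open>0\<close> are
  integrals of continuous functions \<open>f\<^sub>i\<close>, and injectivity says that the translates of the \<open>f\<^sub>i\<close>
  together with \<open>1\<close> separate probability measures, hence span a dense subspace by Hahn--Banach and
  Riesz; so the multiplicity is at most \<open>d + 1\<close>. Ergodic measures are linearly independent on \<open>C(X)\<close>, so
  their number never exceeds the multiplicity. If there are at most \<open>d\<close> of them, constants can be added
  to the \<open>f\<^sub>i\<close> such that \<open>1\<close> is a uniform limit of Birkhoff averages of a combination of the new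
  functions, and then \<open>d\<close> generators suffice.
\<close>

section \<open>Dominated linear functionals\<close>

text \<open>Injectivity of \<open>\<phi>\<close> concerns probability measures only, and all of them
  give the constant 1 the same integral. An embedding therefore yields density only after 1 is
  adjoined, and the dichotomy is about whether that extra generator can be saved. Saving it takes a
  nontrivial solution of one homogeneous equation per ergodic measure, in \<open>d + 1\<close>
  unknowns: the coefficients of the \<open>d\<close> functions and of 1. Up to \<open>d\<close>
  ergodic measures there always is one; beyond that, the lower bound on the multiplicity forces
  \<open>d + 1\<close>. Convex sets of functionals are represented by their support functions. The
  functionals below the supremum are the Borel probability measures, those that also vanish on all
  coboundaries \<open>u - u \<circ> T\<close> are the invariant ones, and extreme points of the
  latter are ergodic. One extension theorem with an extremality clause thus supplies both the
  separating measures for density and, through the duality max \<integral> f = inf sup (f + u - u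
  \<circ> T), the uniform smallness of Birkhoff averages of a function with integral 0 against every
  ergodic measure.\<close>

definition sublinear :: "('v::real_vector \<Rightarrow> real) \<Rightarrow> bool" where
  "sublinear p \<longleftrightarrow> (\<forall>x y. p (x + y) \<le> p x + p y) \<and> (\<forall>c\<ge>0. \<forall>x. p (c *\<^sub>R x) = c * p x)"

lemma sublinear_add: "sublinear p \<Longrightarrow> p (x + y) \<le> p x + p y"
  by (simp add: sublinear_def)

lemma sublinear_scaleR: "sublinear p \<Longrightarrow> 0 \<le> c \<Longrightarrow> p (c *\<^sub>R x) = c * p x"
  by (simp add: sublinear_def)

lemma sublinear_0: "sublinear p \<Longrightarrow> p 0 = 0"
  using sublinear_scaleR[of p 0 0] by simp

lemma sublinear_minus: "sublinear p \<Longrightarrow> - p (- x) \<le> p x"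
  using sublinear_add[of p x "- x"] sublinear_0[of p] by simp

text \<open>Applying the homogeneity inequality with factor \<open>inverse c\<close> to
  \<open>c *\<^sub>R x\<close> gives its converse, so one direction for positive \<open>c\<close>
  suffices.\<close>

lemma sublinearI:
  assumes "\<And>x y. p (x + y) \<le> p x + p y" and "\<And>c x. 0 < c \<Longrightarrow> p (c *\<^sub>R x) \<le> c * p x"
    and "p 0 = 0"
  shows "sublinear p"
proof -
  have "p (c *\<^sub>R x) = c * p x" if "0 \<le> c" for c x
  proof (cases "c = 0")
    case False
    then have "0 < c" using that by simp
    have "p (inverse c *\<^sub>R (c *\<^sub>R x)) \<le> inverse c * p (c *\<^sub>R x)"
      using \<open>0 < c\<close> by (intro assms(2)) simp
    then have "p x \<le> inverse c * p (c *\<^sub>R x)"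
      using \<open>0 < c\<close> by simp
    then have "c * p x \<le> p (c *\<^sub>R x)"
      using \<open>0 < c\<close> by (simp add: field_simps)
    then show ?thesis
      using assms(2)[OF \<open>0 < c\<close>, of x] by simp
  qed (simp add: assms(3))
  then show ?thesis
    using assms(1) by (auto simp: sublinear_def)
qed

lemma linear_if_sublinear_superadditive:
  assumes "sublinear q" and "\<And>x y. q x + q y \<le> q (x + y)"
  shows "linear q"
proof -
  have add: "q (x + y) = q x + q y" for x y
    using assms(2)[of x y] sublinear_add[OF assms(1), of x y] by simp
  have neg: "q (- x) = - q x" for x
    using add[of x "- x"] sublinear_0[OF assms(1)] by simp
  have "q (c *\<^sub>R x) = c * q x" for c x
  proof (cases "0 \<le> c")
    case False
    then have "q ((- c) *\<^sub>R x) = - c * q x"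
      by (intro sublinear_scaleR assms(1)) simp
    then show ?thesis
      using neg[of "c *\<^sub>R x"] by simp
  qed (simp add: sublinear_scaleR assms(1))
  then show ?thesis
    by (intro linearI) (simp_all add: add)
qed

text \<open>An asymmetric quotient norm: if \<open>S\<close> is a subspace on which \<open>p\<close>
  is nonnegative, the linear functionals below it are exactly those below \<open>p\<close> that
  vanish on \<open>S\<close>.\<close>

definition quotient_sublinear :: "('v::real_vector \<Rightarrow> real) \<Rightarrow> 'v set \<Rightarrow> 'v \<Rightarrow> real" where
  "quotient_sublinear p S x = (INF s\<in>S. p (x + s))"

text \<open>Nonnegativity on \<open>S\<close> keeps the infimum finite:
  \<open>0 \<le> p s \<le> p (- x) + p (x + s)\<close>.\<close>

lemma quotient_sublinear_bdd:
  assumes "sublinear p" "\<And>s. s \<in> S \<Longrightarrow> 0 \<le> p s"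
  shows "bdd_below ((\<lambda>s. p (x + s)) ` S)"
proof (rule bdd_belowI2)
  fix s assume "s \<in> S"
  then show "- p (- x) \<le> p (x + s)"
    using sublinear_add[OF assms(1), of "- x" "x + s"] assms(2)[of s] by simp
qed

lemma sublinear_quotient:
  assumes p: "sublinear p" and S: "subspace S" and nonneg: "\<And>s. s \<in> S \<Longrightarrow> 0 \<le> p s"
  shows "sublinear (quotient_sublinear p S)"
proof (rule sublinearI)
  note bdd = quotient_sublinear_bdd[OF p nonneg]
  have ne: "S \<noteq> {}" using subspace_0[OF S] by blast
  show "quotient_sublinear p S (x + y) \<le> quotient_sublinear p S x + quotient_sublinear p S y" for x y
  proof (rule field_le_epsilon)
    fix e :: real assume "0 < e"
    obtain s where s: "s \<in> S" "p (x + s) < quotient_sublinear p S x + e / 2"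
      using cINF_less_iff[OF ne bdd, of x "quotient_sublinear p S x + e / 2"] \<open>0 < e\<close>
      by (auto simp: quotient_sublinear_def)
    obtain t where t: "t \<in> S" "p (y + t) < quotient_sublinear p S y + e / 2"
      using cINF_less_iff[OF ne bdd, of y "quotient_sublinear p S y + e / 2"] \<open>0 < e\<close>
      by (auto simp: quotient_sublinear_def)
    have "quotient_sublinear p S (x + y) \<le> p (x + y + (s + t))"
      unfolding quotient_sublinear_def by (rule cINF_lower[OF bdd subspace_add[OF S s(1) t(1)]])
    also have "\<dots> \<le> p (x + s) + p (y + t)"
      using sublinear_add[OF p, of "x + s" "y + t"] by (simp add: algebra_simps)
    finally show "quotient_sublinear p S (x + y)
        \<le> quotient_sublinear p S x + quotient_sublinear p S y + e"
      using s t by simp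
  qed
  show "quotient_sublinear p S (c *\<^sub>R x) \<le> c * quotient_sublinear p S x" if "0 < c" for c x
  proof -
    have "quotient_sublinear p S (c *\<^sub>R x) / c \<le> quotient_sublinear p S x"
      unfolding quotient_sublinear_def[of p S x]
    proof (rule cINF_greatest[OF ne])
      fix s assume "s \<in> S"
      have "quotient_sublinear p S (c *\<^sub>R x) \<le> p (c *\<^sub>R x + c *\<^sub>R s)"
        unfolding quotient_sublinear_def
        by (rule cINF_lower[OF bdd subspace_scale[OF S \<open>s \<in> S\<close>]])
      also have "\<dots> = c * p (x + s)"
        using sublinear_scaleR[OF p, of c "x + s"] that by (simp add: scaleR_add_right)
      finally show "quotient_sublinear p S (c *\<^sub>R x) / c \<le> p (x + s)"
        using that by (simp add: field_simps)
    qed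
    then show ?thesis using that by (simp add: field_simps)
  qed
  have "quotient_sublinear p S 0 \<le> p (0 + 0)"
    unfolding quotient_sublinear_def by (rule cINF_lower[OF bdd subspace_0[OF S]])
  moreover have "0 \<le> quotient_sublinear p S 0"
    unfolding quotient_sublinear_def by (rule cINF_greatest[OF ne]) (simp add: nonneg)
  ultimately show "quotient_sublinear p S 0 = 0"
    using sublinear_0[OF p] by simp
qed

text \<open>The support functional of the set of all functionals below \<open>q\<close> that are maximal at \<open>y\<close>.\<close>

definition exposed :: "('v::real_vector \<Rightarrow> real) \<Rightarrow> 'v \<Rightarrow> 'v \<Rightarrow> real" where
  "exposed q y x = (INF t\<in>{0..}. q (x + t *\<^sub>R y) - t * q y)"

lemma exposed_lower:
  assumes "sublinear q" "0 \<le> t"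
  shows "exposed q y x \<le> q (x + t *\<^sub>R y) - t * q y"
proof -
  have "bdd_below ((\<lambda>t. q (x + t *\<^sub>R y) - t * q y) ` {0..})"
  proof (rule bdd_belowI2)
    fix t :: real assume "t \<in> {0..}"
    then show "- q (- x) \<le> q (x + t *\<^sub>R y) - t * q y"
      using sublinear_add[OF assms(1), of "- x" "x + t *\<^sub>R y"] sublinear_scaleR[OF assms(1), of t y]
      by simp
  qed
  then show ?thesis
    unfolding exposed_def using assms(2) by (intro cINF_lower) auto
qed

lemma exposed_less:
  assumes "exposed q y x < c"
  obtains t where "0 \<le> t" "q (x + t *\<^sub>R y) - t * q y < c"
proof -
  have "\<not> (\<forall>t\<in>{0..}. c \<le> q (x + t *\<^sub>R y) - t * q y)"
    using assms cINF_greatest[of "{0::real..}" c "\<lambda>t. q (x + t *\<^sub>R y) - t * q y"]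
    by (auto simp: exposed_def)
  then show ?thesis using that by (auto simp: not_le)
qed

lemma sublinear_exposed:
  assumes q: "sublinear q"
  shows "sublinear (exposed q y)"
proof (rule sublinearI)
  show "exposed q y (x + z) \<le> exposed q y x + exposed q y z" for x z
  proof (rule field_le_epsilon)
    fix e :: real assume "0 < e"
    obtain s where s: "0 \<le> s" "q (x + s *\<^sub>R y) - s * q y < exposed q y x + e / 2"
      using exposed_less[of q y x "exposed q y x + e / 2"] \<open>0 < e\<close> by auto
    obtain t where t: "0 \<le> t" "q (z + t *\<^sub>R y) - t * q y < exposed q y z + e / 2"
      using exposed_less[of q y z "exposed q y z + e / 2"] \<open>0 < e\<close> by auto
    have "exposed q y (x + z) \<le> q ((x + z) + (s + t) *\<^sub>R y) - (s + t) * q y"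
      using s t by (intro exposed_lower q) simp
    also have "q ((x + z) + (s + t) *\<^sub>R y) \<le> q (x + s *\<^sub>R y) + q (z + t *\<^sub>R y)"
      using sublinear_add[OF q, of "x + s *\<^sub>R y" "z + t *\<^sub>R y"] by (simp add: algebra_simps)
    finally show "exposed q y (x + z) \<le> exposed q y x + exposed q y z + e"
      using s t by (simp add: algebra_simps)
  qed
  show "exposed q y (c *\<^sub>R x) \<le> c * exposed q y x" if "0 < c" for c x
  proof -
    have "exposed q y (c *\<^sub>R x) / c \<le> exposed q y x"
      unfolding exposed_def[of q y x]
    proof (rule cINF_greatest)
      fix t :: real assume t: "t \<in> {0..}"
      have "exposed q y (c *\<^sub>R x) \<le> q (c *\<^sub>R x + (c * t) *\<^sub>R y) - (c * t) * q y"
        using t that by (intro exposed_lower q) simp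
      also have "\<dots> = c * (q (x + t *\<^sub>R y) - t * q y)"
        using sublinear_scaleR[OF q, of c "x + t *\<^sub>R y"] that by (simp add: algebra_simps)
      finally show "exposed q y (c *\<^sub>R x) / c \<le> q (x + t *\<^sub>R y) - t * q y"
        using that by (simp add: field_simps)
    qed simp
    then show ?thesis using that by (simp add: field_simps)
  qed
  have "exposed q y 0 \<le> 0"
    using exposed_lower[OF q, of 0 y 0] sublinear_0[OF q] by simp
  moreover have "0 \<le> exposed q y 0"
    unfolding exposed_def
    by (rule cINF_greatest) (auto simp: sublinear_scaleR[OF q])
  ultimately show "exposed q y 0 = 0" by simp
qed

text \<open>A convex set of functionals is encoded by its support function, with
  \<open>l \<le> q\<close> as membership. Together with \<open>q \<le> p\<close>, the condition says
  that the functionals below \<open>q\<close> form a face of those below \<open>p\<close>. This lets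
  Zorn's lemma run on sublinear functions, without a topology on the dual.\<close>

definition face_of_sublinear ::
    "('v::real_vector \<Rightarrow> real) \<Rightarrow> ('v \<Rightarrow> real) \<Rightarrow> bool" where
  "face_of_sublinear q p \<longleftrightarrow> (\<forall>l1 l2 t. linear l1 \<longrightarrow> linear l2 \<longrightarrow> l1 \<le> p \<longrightarrow> l2 \<le> p \<longrightarrow>
     0 < t \<longrightarrow> t < 1 \<longrightarrow> (\<forall>x. t * l1 x + (1 - t) * l2 x \<le> q x) \<longrightarrow> l1 \<le> q \<and> l2 \<le> q)"

text \<open>If a mixture of \<open>l1\<close> and \<open>l2\<close> lies below
  \<open>exposed q y\<close>, evaluation at \<open>- y\<close> shows that its value at
  \<open>y\<close> is at least \<open>q y\<close>. Neither functional exceeds \<open>q y\<close>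
  there, so both attain it, and a linear functional below \<open>q\<close> attaining
  \<open>q y\<close> lies below \<open>exposed q y\<close>.\<close>

lemma face_exposed:
  assumes q: "sublinear q" and face: "face_of_sublinear q p"
  shows "face_of_sublinear (exposed q y) p"
  unfolding face_of_sublinear_def
proof (intro allI impI)
  fix l1 l2 :: "'a \<Rightarrow> real" and t :: real
  assume lin: "linear l1" "linear l2" and le: "l1 \<le> p" "l2 \<le> p" and t: "0 < t" "t < 1"
    and mix: "\<forall>x. t * l1 x + (1 - t) * l2 x \<le> exposed q y x"
  have exposed_le: "exposed q y x \<le> q x" for x
    using exposed_lower[OF q, of 0 y x] by simp
  have leq: "l1 \<le> q" "l2 \<le> q"
    using face[unfolded face_of_sublinear_def, rule_format, OF lin le t] mix exposed_le
    by (meson order_trans)+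
  have "t * l1 (- y) + (1 - t) * l2 (- y) \<le> q (- y + 1 *\<^sub>R y) - 1 * q y"
    using mix exposed_lower[OF q, of 1 y "- y"] by (meson order_trans zero_le_one)
  then have ge: "q y \<le> t * l1 y + (1 - t) * l2 y"
    using sublinear_0[OF q] by (simp add: linear_neg[OF lin(1)] linear_neg[OF lin(2)])
  have le1: "t * l1 y \<le> t * q y" and le2: "(1 - t) * l2 y \<le> (1 - t) * q y"
    using leq t by (auto simp: le_fun_def intro!: mult_left_mono)
  have "t * q y \<le> t * l1 y" "(1 - t) * q y \<le> (1 - t) * l2 y"
    using ge le1 le2 by (simp_all add: algebra_simps)
  then have eq: "l1 y = q y" "l2 y = q y"
    using t leq by (auto simp: le_fun_def intro: antisym)
  have "l x \<le> exposed q y x" if "linear l" "l \<le> q" "l y = q y" for l x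
    unfolding exposed_def
  proof (rule cINF_greatest)
    fix s :: real assume "s \<in> {0..}"
    have "l (x + s *\<^sub>R y) = l x + s * q y"
      using that by (simp add: linear_add linear_scale)
    then show "l x \<le> q (x + s *\<^sub>R y) - s * q y"
      using le_funD[OF that(2), of "x + s *\<^sub>R y"] by simp
  qed simp
  then show "l1 \<le> exposed q y \<and> l2 \<le> exposed q y"
    using lin leq eq by (simp add: le_fun_def)
qed

text \<open>Domination by \<open>p\<close> keeps the infimum finite, since
  \<open>- p (- x) \<le> q x\<close>. Subadditivity uses the chain: the smaller of two
  near-minimisers, one for \<open>x\<close> and one for \<open>y\<close>, serves both
  points.\<close>

lemma sublinear_chain_Inf:
  assumes ne: "C \<noteq> {}" and sub: "\<And>q. q \<in> C \<Longrightarrow> sublinear q" and le: "\<And>q. q \<in> C \<Longrightarrow> q \<le> p"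
    and chain: "\<And>q r. q \<in> C \<Longrightarrow> r \<in> C \<Longrightarrow> q \<le> r \<or> r \<le> q"
  shows "sublinear (\<lambda>x. INF q\<in>C. q x)" and "\<And>q x. q \<in> C \<Longrightarrow> (INF q\<in>C. q x) \<le> q x"
proof -
  have bdd: "bdd_below ((\<lambda>q. q x) ` C)" for x
  proof (rule bdd_belowI2)
    fix q assume "q \<in> C"
    then show "- p (- x) \<le> q x"
      using sublinear_minus[OF sub, of q x] le_funD[OF le, of q "- x"] by simp
  qed
  show lower: "(INF q\<in>C. q x) \<le> q x" if "q \<in> C" for q x
    by (rule cINF_lower[OF bdd that])
  show "sublinear (\<lambda>x. INF q\<in>C. q x)"
  proof (rule sublinearI)
    show "(INF q\<in>C. q (x + y)) \<le> (INF q\<in>C. q x) + (INF q\<in>C. q y)" for x y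
    proof (rule field_le_epsilon)
      fix e :: real assume "0 < e"
      obtain q where q: "q \<in> C" "q x < (INF q\<in>C. q x) + e / 2"
        using cINF_less_iff[OF ne bdd, of x "(INF q\<in>C. q x) + e / 2"] \<open>0 < e\<close> by auto
      obtain r where r: "r \<in> C" "r y < (INF q\<in>C. q y) + e / 2"
        using cINF_less_iff[OF ne bdd, of y "(INF q\<in>C. q y) + e / 2"] \<open>0 < e\<close> by auto
      obtain m where m: "m \<in> C" "m \<le> q" "m \<le> r"
        using chain[OF q(1) r(1)] q(1) r(1) by blast
      have "(INF q\<in>C. q (x + y)) \<le> m (x + y)" by (rule lower[OF m(1)])
      also have "\<dots> \<le> m x + m y" by (rule sublinear_add[OF sub[OF m(1)]])
      also have "\<dots> \<le> q x + r y" using m by (intro add_mono) (auto simp: le_fun_def)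
      finally show "(INF q\<in>C. q (x + y)) \<le> (INF q\<in>C. q x) + (INF q\<in>C. q y) + e"
        using q r by simp
    qed
    show "(INF q\<in>C. q (c *\<^sub>R x)) \<le> c * (INF q\<in>C. q x)" if "0 < c" for c x
    proof -
      have "(INF q\<in>C. q (c *\<^sub>R x)) / c \<le> (INF q\<in>C. q x)"
      proof (rule cINF_greatest[OF ne])
        fix q assume "q \<in> C"
        then have "(INF q\<in>C. q (c *\<^sub>R x)) \<le> c * q x"
          using lower[of q "c *\<^sub>R x"] sublinear_scaleR[OF sub, of q c x] that by simp
        then show "(INF q\<in>C. q (c *\<^sub>R x)) / c \<le> q x"
          using that by (simp add: field_simps)
      qed
      then show ?thesis using that by (simp add: field_simps)
    qed
    show "(INF q\<in>C. q 0) = 0"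
      using ne sub by (simp add: sublinear_0 cong: INF_cong_simp)
  qed
qed

text \<open>Zorn's lemma yields a minimal face below \<open>exposed p y\<close>; minimality against
  \<^const>\<open>exposed\<close> forces additivity. This is Hahn--Banach and Krein--Milman at once.\<close>

lemma exists_extreme_linear_below_sublinear:
  fixes p :: "'v::real_vector \<Rightarrow> real"
  assumes p: "sublinear p"
  obtains l where "linear l" "l \<le> p" "l y = p y"
    "\<And>l1 l2 t. linear l1 \<Longrightarrow> linear l2 \<Longrightarrow> l1 \<le> p \<Longrightarrow> l2 \<le> p \<Longrightarrow> 0 < t \<Longrightarrow> t < 1 \<Longrightarrow>
       (\<And>x. l x = t * l1 x + (1 - t) * l2 x) \<Longrightarrow> l1 = l"
proof -
  define F where "F = {q. sublinear q \<and> q \<le> exposed p y \<and> face_of_sublinear q p}"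
  define R where "R q r \<longleftrightarrow> r \<le> q" for q r :: "'v \<Rightarrow> real"
  \<comment> \<open>All functionals below \<open>p\<close> trivially form a face of themselves, and
    exposing in direction \<open>y\<close> preserves faces.\<close>
  have base: "exposed p y \<in> F"
    using sublinear_exposed[OF p] face_exposed[OF p, of p y]
    by (auto simp: F_def face_of_sublinear_def)
  have "\<exists>m\<in>F. \<forall>a\<in>F. R m a \<longrightarrow> a = m"
  proof (rule predicate_Zorn)
    show "partial_order_on F (relation_of R F)"
      by (auto simp: R_def partial_order_on_def preorder_on_def refl_on_def trans_def antisym_def
          relation_of_def intro: antisym order_trans)
    fix C assume C: "C \<in> Chains (relation_of R F)"
    then have CF: "C \<subseteq> F" by (auto simp: Chains_def relation_of_def)
    show "\<exists>u\<in>F. \<forall>a\<in>C. R a u"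
    proof (cases "C = {}")
      case True
      then show ?thesis using base by auto
    next
      case False
      have "sublinear q" "q \<le> exposed p y" "face_of_sublinear q p" if "q \<in> C" for q
        using that CF by (auto simp: F_def)
      moreover have "q \<le> r \<or> r \<le> q" if "q \<in> C" "r \<in> C" for q r
        using C that by (auto simp: Chains_def relation_of_def R_def)
      ultimately have inf: "sublinear (\<lambda>x. INF q\<in>C. q x)"
        "\<And>q x. q \<in> C \<Longrightarrow> (INF q\<in>C. q x) \<le> q x"
        using sublinear_chain_Inf[OF False, of "exposed p y"] by blast+
      have "face_of_sublinear (\<lambda>x. INF q\<in>C. q x) p"
        unfolding face_of_sublinear_def
      proof (intro allI impI)
        fix l1 l2 :: "'v \<Rightarrow> real" and t :: real
        assume lin: "linear l1" "linear l2" and le: "l1 \<le> p" "l2 \<le> p" and t: "0 < t" "t < 1"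
          and mix: "\<forall>x. t * l1 x + (1 - t) * l2 x \<le> (INF q\<in>C. q x)"
        have "l1 \<le> q \<and> l2 \<le> q" if "q \<in> C" for q
        proof -
          have "face_of_sublinear q p" using that CF by (auto simp: F_def)
          then show ?thesis
            using lin le t mix inf(2)[OF that] unfolding face_of_sublinear_def
            by (meson order_trans)
        qed
        then show "l1 \<le> (\<lambda>x. INF q\<in>C. q x) \<and> l2 \<le> (\<lambda>x. INF q\<in>C. q x)"
          using False by (auto simp: le_fun_def intro!: cINF_greatest)
      qed
      moreover have "(\<lambda>x. INF q\<in>C. q x) \<le> exposed p y"
        using False CF inf(2) unfolding F_def le_fun_def
        by (metis (no_types, lifting) ex_in_conv mem_Collect_eq order_trans subsetD)
      ultimately have "(\<lambda>x. INF q\<in>C. q x) \<in> F"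
        using inf(1) by (simp add: F_def)
      moreover have "\<forall>a\<in>C. R a (\<lambda>x. INF q\<in>C. q x)"
        using inf(2) by (simp add: R_def le_fun_def)
      ultimately show ?thesis by blast
    qed
  qed
  then obtain l where l: "l \<in> F" and min: "\<And>q. q \<in> F \<Longrightarrow> q \<le> l \<Longrightarrow> q = l"
    by (auto simp: R_def)
  have sub: "sublinear l" and le: "l \<le> exposed p y" and face: "face_of_sublinear l p"
    using l by (auto simp: F_def)
  have exposed_eq: "exposed l z = l" for z
  proof (rule min)
    show below: "exposed l z \<le> l"
      using exposed_lower[OF sub, of 0 z] by (simp add: le_fun_def)
    show "exposed l z \<in> F"
      using below le face_exposed[OF sub face] sublinear_exposed[OF sub]
      by (auto simp: F_def)
  qed
  have "linear l"
  proof (rule linear_if_sublinear_superadditive[OF sub])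
    \<comment> \<open>Parameter 1 in the infimum defining \<open>exposed l z = l\<close> gives
      \<open>l x \<le> l (x + z) - l z\<close>.\<close>
    show "l x + l z \<le> l (x + z)" for x z
      using exposed_lower[OF sub, of 1 z x] exposed_eq[of z] by simp
  qed
  moreover have lp: "l \<le> p"
    using le exposed_lower[OF p, of 0 y] by (auto simp: le_fun_def intro: order_trans)
  moreover have "l y = p y"
  proof (rule antisym)
    show "l y \<le> p y" using lp by (simp add: le_fun_def)
    \<comment> \<open>Parameter 1 again: at \<open>- y\<close> the value of
      \<open>exposed p y\<close> is at most \<open>- p y\<close>, which forces maximality at
      \<open>y\<close>.\<close>
    have "l (- y) \<le> p (- y + 1 *\<^sub>R y) - 1 * p y"
      using le_funD[OF le, of "- y"] exposed_lower[OF p, of 1 y "- y"] by simp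
    then show "p y \<le> l y"
      using sublinear_0[OF p] linear_neg[OF \<open>linear l\<close>] by simp
  qed
  moreover have "l1 = l" if "linear l1" "linear l2" "l1 \<le> p" "l2 \<le> p" "0 < t" "t < 1"
    "\<And>x. l x = t * l1 x + (1 - t) * l2 x" for l1 l2 t
  proof -
    have "l1 \<le> l"
      using face[unfolded face_of_sublinear_def, rule_format, of l1 l2 t] that by simp
    then have le: "l1 x \<le> l x" for x
      by (simp add: le_fun_def)
    have "l x \<le> l1 x" for x
      using le[of "- x"] linear_neg[OF \<open>linear l\<close>, of x] linear_neg[OF that(1), of x] by simp
    with le show ?thesis
      by (intro ext antisym)
  qed
  ultimately show ?thesis using that by blast
qed

text \<open>The extreme functional is taken below the quotient of \<open>p\<close> by
  \<open>S\<close>, which turns vanishing on \<open>S\<close> into mere domination. It is applied to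
  the supremum modulo coboundaries, to find ergodic measures, and to a sum of two suprema on a
  product space, to separate a function from a subspace.\<close>

lemma exists_extreme_linear_vanishing_on_subspace:
  fixes p :: "'v::real_vector \<Rightarrow> real"
  assumes p: "sublinear p" and S: "subspace S" and nonneg: "\<And>s. s \<in> S \<Longrightarrow> 0 \<le> p s"
  obtains l where "linear l" "l \<le> p" "\<And>s. s \<in> S \<Longrightarrow> l s = 0" "l y = (INF s\<in>S. p (y + s))"
    "\<And>l1 l2 t. linear l1 \<Longrightarrow> linear l2 \<Longrightarrow> l1 \<le> p \<Longrightarrow> l2 \<le> p \<Longrightarrow>
       (\<And>s. s \<in> S \<Longrightarrow> l1 s = 0) \<Longrightarrow> (\<And>s. s \<in> S \<Longrightarrow> l2 s = 0) \<Longrightarrow> 0 < t \<Longrightarrow> t < 1 \<Longrightarrow>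
       (\<And>x. l x = t * l1 x + (1 - t) * l2 x) \<Longrightarrow> l1 = l"
proof -
  let ?q = "quotient_sublinear p S"
  obtain l where l: "linear l" "l \<le> ?q" "l y = ?q y"
    and extreme: "\<And>l1 l2 t. linear l1 \<Longrightarrow> linear l2 \<Longrightarrow> l1 \<le> ?q \<Longrightarrow> l2 \<le> ?q \<Longrightarrow> 0 < t \<Longrightarrow> t < 1 \<Longrightarrow>
       (\<And>x. l x = t * l1 x + (1 - t) * l2 x) \<Longrightarrow> l1 = l"
    using exists_extreme_linear_below_sublinear[OF sublinear_quotient[OF p S nonneg]] by metis
  have lower: "?q x \<le> p (x + s)" if "s \<in> S" for x s
    unfolding quotient_sublinear_def
    by (rule cINF_lower[OF quotient_sublinear_bdd[OF p nonneg] that])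
  have "l s \<le> 0" if "s \<in> S" for s
    using lower[OF subspace_neg[OF S that], of s] le_funD[OF l(2), of s] sublinear_0[OF p]
    by simp
  then have zero: "l s = 0" if "s \<in> S" for s
    using that subspace_neg[OF S that] linear_neg[OF l(1)] by (metis antisym neg_le_0_iff_le)
  have le: "l \<le> p"
  proof (rule le_funI)
    show "l x \<le> p x" for x
      using le_funD[OF l(2), of x] lower[OF subspace_0[OF S], of x] by simp
  qed
  have below: "l' \<le> ?q" if "linear l'" "l' \<le> p" "\<And>s. s \<in> S \<Longrightarrow> l' s = 0" for l'
    unfolding le_fun_def quotient_sublinear_def
  proof (intro allI cINF_greatest)
    fix x s assume "s \<in> S"
    then show "l' x \<le> p (x + s)"
      using that le_funD[OF that(2), of "x + s"] by (simp add: linear_add)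
  qed (use subspace_0[OF S] in auto)
  show ?thesis
  proof (rule that)
    show "l1 = l" if "linear l1" "linear l2" "l1 \<le> p" "l2 \<le> p" "\<And>s. s \<in> S \<Longrightarrow> l1 s = 0"
      "\<And>s. s \<in> S \<Longrightarrow> l2 s = 0" "0 < t" "t < 1" "\<And>x. l x = t * l1 x + (1 - t) * l2 x" for l1 l2 t
      using that by (intro extreme[of l1 l2 t] below)
  qed (fact l(1) le zero l(3)[unfolded quotient_sublinear_def])+
qed

text \<open>Gaussian elimination: each equation is either trivial or eliminates one unknown, so
  unknowns remain after all equations are used.\<close>

lemma homogeneous_system_nontrivial_solution:
  fixes c :: "'i \<Rightarrow> 'j \<Rightarrow> real"
  assumes "finite I" "finite J" "card I < card J"
  obtains a where "\<And>i. i \<in> I \<Longrightarrow> (\<Sum>j\<in>J. a j * c i j) = 0" "\<exists>j\<in>J. a j \<noteq> 0"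
proof -
  have "\<exists>a. (\<forall>i\<in>I. (\<Sum>j\<in>J. a j * c i j) = 0) \<and> (\<exists>j\<in>J. a j \<noteq> 0)"
    using assms
  proof (induction I arbitrary: J c rule: finite_induct)
    case empty
    then have "J \<noteq> {}" by auto
    then show ?case by (intro exI[of _ "\<lambda>_. 1"]) auto
  next
    case (insert i0 I)
    show ?case
    proof (cases "\<forall>j\<in>J. c i0 j = 0")
      case True
      have "card I < card J" using insert by simp
      then obtain a where "\<forall>i\<in>I. (\<Sum>j\<in>J. a j * c i j) = 0" "\<exists>j\<in>J. a j \<noteq> 0"
        using insert.IH[of J c] insert.prems by blast
      then show ?thesis using True by auto
    next
      case False
      then obtain k where k: "k \<in> J" "c i0 k \<noteq> 0" by blast
      define c' where "c' i j = c i j - c i0 j / c i0 k * c i k" for i j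
      have "card I < card (J - {k})" using insert k by simp
      then obtain a where a: "\<forall>i\<in>I. (\<Sum>j\<in>J - {k}. a j * c' i j) = 0" "\<exists>j\<in>J - {k}. a j \<noteq> 0"
        using insert.IH[of "J - {k}" c'] insert.prems by blast
      define s where "s = (\<Sum>j\<in>J - {k}. a j * c i0 j)"
      \<comment> \<open>The value at \<open>k\<close> is forced by equation \<open>i0\<close>;
        substituting it into the other equations produces the coefficients
        \<open>c'\<close>.\<close>
      define b where "b = a(k := - s / c i0 k)"
      have b: "(\<Sum>j\<in>J. b j * c i j) = (\<Sum>j\<in>J - {k}. a j * c i j) - s / c i0 k * c i k" for i
        using insert.prems k by (simp add: sum.remove[of J k] b_def)
      have "(\<Sum>j\<in>J. b j * c i j) = 0" if "i \<in> I" for i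
      proof -
        have "(\<Sum>j\<in>J - {k}. a j * c' i j)
            = (\<Sum>j\<in>J - {k}. a j * c i j) - (\<Sum>j\<in>J - {k}. a j * c i0 j) / c i0 k * c i k"
          by (simp add: c'_def sum_subtractf sum_distrib_right sum_distrib_left sum_divide_distrib
              algebra_simps)
        then show ?thesis using a(1) that by (simp add: b s_def)
      qed
      moreover have "(\<Sum>j\<in>J. b j * c i0 j) = 0"
        using k by (simp add: b s_def)
      moreover have "\<exists>j\<in>J. b j \<noteq> 0" using a(2) by (auto simp: b_def)
      ultimately show ?thesis by (intro exI[of _ b]) auto
    qed
  qed
  then show ?thesis using that by blast
qed

section \<open>The Riesz representation theorem\<close>

locale compact_metrizable =
  fixes space_type :: "'a::topological_space itself"
  assumes compact_UNIV: "compact (UNIV :: 'a set)"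
    and metrizable: "metrizable_space (euclidean :: 'a topology)"
begin

lemma continuous_bounded:
  fixes f :: "'a \<Rightarrow> real"
  assumes "continuous_on UNIV f"
  obtains b where "0 < b" "\<And>x. \<bar>f x\<bar> \<le> b"
proof -
  have "bounded (range f)"
    using compact_continuous_image[OF assms compact_UNIV] by (rule compact_imp_bounded)
  then show ?thesis
    using that by (auto simp: bounded_pos)
qed

text \<open>Compactness in the form of Dini's argument: a finite subcover of an increasing cover is
  contained in its last member.\<close>

lemma directed_open_cover:
  fixes U :: "nat \<Rightarrow> 'a set"
  assumes "\<And>n. open (U n)" "incseq U" "(\<Union>n. U n) = UNIV"
  obtains n where "U n = UNIV"
proof -
  obtain C where C: "finite C" "UNIV \<subseteq> (\<Union>n\<in>C. U n)"
    using compactE_image[OF compact_UNIV, of UNIV U] assms by auto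
  have "U n \<subseteq> U (Max C)" if "n \<in> C" for n
    using incseqD[OF assms(2)] Max_ge[OF C(1) that] by blast
  with C(2) have "U (Max C) = UNIV" by blast
  then show ?thesis using that by blast
qed

text \<open>Closed sets in a metrizable space are countable intersections of open sets
  \<open>U n\<close>. Urysohn functions equal to 1 on \<open>C\<close> and 0 off \<open>U n\<close>
  are multiplied up to make the sequence decrease; the empty product gives the start value 1, on
  which later telescoping relies.\<close>

lemma closed_indicator_decreasing_limit:
  fixes C :: "'a set"
  assumes "closed C"
  obtains g :: "nat \<Rightarrow> 'a \<Rightarrow> real" where
    "\<And>k. continuous_on UNIV (g k)" "\<And>x. g 0 x = 1" "\<And>k x. 0 \<le> g k x"
    "\<And>k x. g (Suc k) x \<le> g k x" "\<And>k x. x \<in> C \<Longrightarrow> g k x = 1" "\<And>x. (\<lambda>k. g k x) \<longlonglongrightarrow> indicator C x"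
proof -
  have "gdelta_in euclidean C"
    using closed_imp_gdelta_in[OF metrizable] assms by simp
  then obtain U :: "nat \<Rightarrow> 'a set" where "\<forall>n. openin euclidean (U n)" "\<Inter> (range U) = C"
    unfolding gdelta_in_descending by blast
  then have U: "\<And>n. open (U n)" "\<Inter> (range U) = C" by simp_all
  have "\<exists>f. continuous_on UNIV f \<and> (\<forall>x. 0 \<le> f x \<and> f x \<le> 1) \<and> (\<forall>x\<in>C. f x = (1::real)) \<and>
      (\<forall>x. x \<notin> U n \<longrightarrow> f x = 0)" for n
  proof -
    have "disjnt (- U n) C" using U(2) by (auto simp: disjnt_def)
    then obtain f where "continuous_map euclidean (top_of_set {0..1::real}) f"
      "f ` (- U n) \<subseteq> {0}" "f ` C \<subseteq> {1}"
      using Urysohn_lemma[OF metrizable_imp_normal_space[OF metrizable], of "- U n" C 0 1] U(1) assms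
      by (auto simp: closed_def)
    then show ?thesis
      by (intro exI[of _ f]) (auto simp: continuous_map_in_subtopology image_subset_iff)
  qed
  then obtain f where f: "\<And>n. continuous_on UNIV (f n)" "\<And>n x. 0 \<le> f n x" "\<And>n x. f n x \<le> (1::real)"
    "\<And>n x. x \<in> C \<Longrightarrow> f n x = 1" "\<And>n x. x \<notin> U n \<Longrightarrow> f n x = 0"
    by metis
  define g where "g k x = (\<Prod>n<k. f n x)" for k x
  show ?thesis
  proof (rule that)
    show "continuous_on UNIV (g k)" for k
      unfolding g_def by (intro continuous_intros f)
    show "g 0 x = 1" for x by (simp add: g_def)
    show nonneg: "0 \<le> g k x" for k x by (simp add: g_def f prod_nonneg)
    show "g (Suc k) x \<le> g k x" for k x
      using mult_left_mono[OF f(3)[of k x] nonneg[of k x]] by (simp add: g_def)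
    show one: "g k x = 1" if "x \<in> C" for k x by (simp add: g_def f(4)[OF that])
    show "(\<lambda>k. g k x) \<longlonglongrightarrow> indicator C x" for x
    proof (cases "x \<in> C")
      case True
      then show ?thesis by (simp add: one)
    next
      case False
      then obtain n where "x \<notin> U n" using U(2) by auto
      then have "g k x = 0" if "Suc n \<le> k" for k
        using that f(5) unfolding g_def by (intro prod_zero) (auto simp: Suc_le_eq)
      then have "(\<lambda>k. g k x) \<longlonglongrightarrow> 0"
        by (intro tendsto_eventually) (auto simp: eventually_sequentially)
      then show ?thesis using False by simp
    qed
  qed
qed

end

text \<open>\<open>L\<close> takes arbitrary functions but is constrained only on continuous ones,
  so sums and products can be formed pointwise without wrapping them into the type of bounded
  continuous functions.\<close>

locale positive_functional = compact_metrizable space_type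
    for space_type :: "'a::topological_space itself" +
  fixes L :: "('a \<Rightarrow> real) \<Rightarrow> real"
  assumes L_add: "continuous_on UNIV f \<Longrightarrow> continuous_on UNIV g \<Longrightarrow> L (\<lambda>x. f x + g x) = L f + L g"
    and L_scale: "continuous_on UNIV f \<Longrightarrow> L (\<lambda>x. c * f x) = c * L f"
    and L_nonneg: "continuous_on UNIV f \<Longrightarrow> (\<And>x. 0 \<le> f x) \<Longrightarrow> 0 \<le> L f"
    and L_one: "L (\<lambda>_. 1) = 1"
begin

lemma L_const: "L (\<lambda>_. c) = c"
  using L_scale[of "\<lambda>_. 1" c] L_one by simp

lemma L_diff:
  "continuous_on UNIV f \<Longrightarrow> continuous_on UNIV g \<Longrightarrow> L (\<lambda>x. f x - g x) = L f - L g"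
  using L_add[of f "\<lambda>x. - 1 * g x"] L_scale[of g "- 1"] by (simp add: continuous_intros)

lemma L_mono:
  "continuous_on UNIV f \<Longrightarrow> continuous_on UNIV g \<Longrightarrow> (\<And>x. f x \<le> g x) \<Longrightarrow> L f \<le> L g"
  using L_nonneg[of "\<lambda>x. g x - f x"] L_diff[of g f] by (simp add: continuous_intros)

lemma L_sum:
  assumes "\<And>n. continuous_on UNIV (f n)"
  shows "L (\<lambda>x. \<Sum>n<(N::nat). f n x) = (\<Sum>n<N. L (f n))"
proof (induction N)
  case 0
  then show ?case using L_const[of 0] by simp
next
  case (Suc N)
  have "L (\<lambda>x. (\<Sum>n<N. f n x) + f N x) = L (\<lambda>x. \<Sum>n<N. f n x) + L (f N)"
    by (intro L_add continuous_intros assms)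
  with Suc show ?case by simp
qed

section \<open>The Daniell outer measure of a positive functional\<close>

definition majorant :: "(nat \<Rightarrow> 'a \<Rightarrow> real) \<Rightarrow> 'a set \<Rightarrow> bool" where
  "majorant f A \<longleftrightarrow> (\<forall>n. continuous_on UNIV (f n) \<and> (\<forall>x. 0 \<le> f n x)) \<and>
     (\<forall>x\<in>A. 1 \<le> (\<Sum>n. ennreal (f n x)))"

text \<open>Daniell's upper integral of the indicator of \<open>A\<close>. Allowing countable
  families of majorising functions, rather than single ones, is what makes it countably
  subadditive.\<close>

definition outer :: "'a set \<Rightarrow> ennreal" where
  "outer A = (INF f\<in>{f. majorant f A}. \<Sum>n. ennreal (L (f n)))"

lemma outer_le: "majorant f A \<Longrightarrow> outer A \<le> (\<Sum>n. ennreal (L (f n)))"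
  unfolding outer_def by (rule INF_lower) simp

lemma outer_le_single:
  assumes "continuous_on UNIV f" "\<And>x. 0 \<le> f x" "\<And>x. x \<in> A \<Longrightarrow> 1 \<le> f x"
  shows "outer A \<le> ennreal (L f)"
proof -
  define F where "F n = (if n = 0 then f else (\<lambda>_. 0))" for n :: nat
  have sums: "(\<lambda>n. if n = 0 then c else 0) sums c" for c :: ennreal
    using sums_single[of 0 "\<lambda>_. c"] by simp
  have "(\<lambda>n. ennreal (F n x)) = (\<lambda>n. if n = 0 then ennreal (f x) else 0)" for x
    by (auto simp: F_def)
  then have "(\<Sum>n. ennreal (F n x)) = ennreal (f x)" for x
    using sums_unique[OF sums[of "ennreal (f x)"]] by simp
  then have "majorant F A"
    using assms by (auto simp: majorant_def F_def)
  then have "outer A \<le> (\<Sum>n. ennreal (L (F n)))" by (rule outer_le)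
  also have "(\<lambda>n. ennreal (L (F n))) = (\<lambda>n. if n = 0 then ennreal (L f) else 0)"
    using L_const[of 0] by (auto simp: F_def)
  also have "suminf \<dots> = ennreal (L f)"
    using sums_unique[OF sums[of "ennreal (L f)"]] by simp
  finally show ?thesis .
qed

lemma outer_empty: "outer {} = 0"
  using outer_le_single[of "\<lambda>_. 0" "{}"] L_const[of 0] by simp

lemma outer_mono: "A \<subseteq> B \<Longrightarrow> outer A \<le> outer B"
  unfolding outer_def by (rule INF_superset_mono) (auto simp: majorant_def)

lemma outer_finite: "outer A < \<infinity>"
proof -
  have "outer A \<le> 1"
    using outer_le_single[of "\<lambda>_. 1" A] L_one by simp
  also have "1 < (\<infinity>::ennreal)" by simp
  finally show ?thesis .
qed

lemma majorant_Union:
  assumes "\<And>i. majorant (F i) (A i)"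
  shows "majorant (\<lambda>m. case prod_decode m of (i, n) \<Rightarrow> F i n) (\<Union>i. A i)"
  unfolding majorant_def
proof (intro conjI allI ballI)
  fix x assume "x \<in> (\<Union>i. A i)"
  then obtain i where i: "x \<in> A i" by blast
  have "1 \<le> (\<Sum>n. ennreal (F i n x))"
    using assms[of i] i by (simp add: majorant_def)
  also have "\<dots> = (\<Sum>j. if j = i then (\<Sum>n. ennreal (F j n x)) else 0)"
    using sums_unique[OF sums_single[of i "\<lambda>j. \<Sum>n. ennreal (F j n x)"]] by simp
  also have "\<dots> \<le> (\<Sum>j. \<Sum>n. ennreal (F j n x))"
    by (intro suminf_le) auto
  also have "\<dots> = (\<Sum>m. (\<lambda>(i, n). ennreal (F i n x)) (prod_decode m))"
    by (intro suminf_ennreal_2dimen[symmetric]) simp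
  finally show "1 \<le> (\<Sum>m. ennreal ((case prod_decode m of (i, n) \<Rightarrow> F i n) x))"
    by (simp add: case_prod_beta)
qed (use assms in \<open>auto simp: majorant_def split: prod.split\<close>)

lemma outer_Union_le: "outer (\<Union>i. A i) \<le> (\<Sum>i. outer (A i))"
proof (rule ennreal_le_epsilon)
  fix e :: real assume "0 < e"
  \<comment> \<open>Finiteness of \<open>outer (A i)\<close> makes the slack strict; the slacks sum
    to \<open>e\<close>.\<close>
  have "\<exists>f. majorant f (A i) \<and> (\<Sum>n. ennreal (L (f n))) \<le> outer (A i) + e * (1 / 2) ^ Suc i" for i
  proof -
    have "outer (A i) < outer (A i) + ennreal (e * (1 / 2) ^ Suc i)"
      using outer_finite[of "A i"] \<open>0 < e\<close>
      by (cases "outer (A i)") (auto simp: ennreal_plus[symmetric] ennreal_less_iff simp del: ennreal_plus)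
    then have "\<exists>f\<in>{f. majorant f (A i)}. (\<Sum>n. ennreal (L (f n))) < outer (A i) + e * (1 / 2) ^ Suc i"
      unfolding outer_def[of "A i"] by (subst (asm) INF_less_iff)
    then show ?thesis by (auto intro: less_imp_le)
  qed
  then obtain F where F: "\<And>i. majorant (F i) (A i)"
    and le: "\<And>i. (\<Sum>n. ennreal (L (F i n))) \<le> outer (A i) + e * (1 / 2) ^ Suc i"
    by metis
  have "outer (\<Union>i. A i) \<le> (\<Sum>m. ennreal (L (case prod_decode m of (i, n) \<Rightarrow> F i n)))"
    by (rule outer_le[OF majorant_Union[OF F]])
  also have "\<dots> = (\<Sum>m. (\<lambda>(i, n). ennreal (L (F i n))) (prod_decode m))"
    by (simp add: case_prod_beta)
  also have "\<dots> = (\<Sum>i. \<Sum>n. ennreal (L (F i n)))"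
    by (intro suminf_ennreal_2dimen) simp
  also have "\<dots> \<le> (\<Sum>i. outer (A i) + e * (1 / 2) ^ Suc i)"
    by (intro suminf_le le) auto
  also have "\<dots> = (\<Sum>i. outer (A i)) + (\<Sum>i. ennreal (e * (1 / 2) ^ Suc i))"
    by (rule suminf_add[symmetric]) auto
  also have "(\<Sum>i. ennreal (e * (1 / 2) ^ Suc i)) = ennreal e"
    using \<open>0 < e\<close> sums_mult[OF power_half_series, of e] by (intro suminf_ennreal_eq) auto
  finally show "outer (\<Union>i. A i) \<le> (\<Sum>i. outer (A i)) + ennreal e" .
qed

lemma outer_measure_space_outer: "outer_measure_space (Pow UNIV) outer"
  unfolding outer_measure_space_def positive_def increasing_def countably_subadditive_def
  using outer_empty outer_mono outer_Union_le by auto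

lemma outer_Un_le: "outer (A \<union> B) \<le> outer A + outer B"
proof -
  have "outer (\<Union>i. binaryset A B i) \<le> (\<Sum>i. outer (binaryset A B i))"
    by (rule outer_Union_le)
  then show ?thesis
    using suminf_binaryset_eq[of outer A B] outer_empty by (simp add: UN_binaryset_eq)
qed

text \<open>With \<open>g k\<close> decreasing from 1 to the indicator of \<open>C\<close>, the
  differences \<open>D k\<close> sum to 1 off \<open>C\<close>. So a majorant \<open>f\<close> of
  \<open>A\<close> splits: the products \<open>f n * D k\<close> majorise \<open>A - C\<close>, and
  for every \<open>K\<close> the products \<open>f n * g K\<close> majorise
  \<open>A \<inter> C\<close>. By telescoping, the cost of \<open>f\<close> is that of
  \<open>f n * g K\<close> plus those of \<open>f n * D k\<close> for \<open>k < K\<close>; then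
  \<open>K\<close> tends to infinity.\<close>

lemma closed_outer_split:
  assumes "closed C"
  shows "outer (A \<inter> C) + outer (A - C) \<le> outer A"
proof (rule closed_indicator_decreasing_limit[OF assms])
  fix g :: "nat \<Rightarrow> 'a \<Rightarrow> real"
  assume g: "\<And>k. continuous_on UNIV (g k)" "\<And>x. g 0 x = 1" "\<And>k x. 0 \<le> g k x"
    "\<And>k x. g (Suc k) x \<le> g k x" "\<And>k x. x \<in> C \<Longrightarrow> g k x = 1"
    "\<And>x. (\<lambda>k. g k x) \<longlonglongrightarrow> indicator C x"
  define D where "D k x = g k x - g (Suc k) x" for k x
  have D: "continuous_on UNIV (D k)" "0 \<le> D k x" for k x
    by (auto simp: D_def[abs_def] g(4) intro!: continuous_intros g(1))
  have sumD: "(\<Sum>k. ennreal (D k x)) = 1" if "x \<notin> C" for x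
  proof -
    have "(\<lambda>k. D k x) sums 1"
      using telescope_sums'[OF g(6)[of x]] that by (simp add: D_def g(2))
    then have "(\<Sum>k. ennreal (D k x)) = ennreal 1"
      by (rule suminf_ennreal_eq[OF D(2)])
    then show ?thesis by simp
  qed
  have "outer (A \<inter> C) + outer (A - C) \<le> (\<Sum>n. ennreal (L (f n)))" if maj: "majorant f A" for f
  proof -
    have f: "continuous_on UNIV (f n)" "0 \<le> f n x" for n x
      using maj by (auto simp: majorant_def)
    define a where "a k = (\<Sum>n. ennreal (L (\<lambda>x. f n x * D k x)))" for k
    have split: "(\<Sum>k<K. a k) + (\<Sum>n. ennreal (L (\<lambda>x. f n x * g K x))) = (\<Sum>n. ennreal (L (f n)))" for K
    proof (induction K)
      case 0
      then show ?case by (simp add: g)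
    next
      case (Suc K)
      have "L (\<lambda>x. f n x * g K x) = L (\<lambda>x. f n x * D K x) + L (\<lambda>x. f n x * g (Suc K) x)" for n
        using L_add[of "\<lambda>x. f n x * D K x" "\<lambda>x. f n x * g (Suc K) x"]
        by (simp add: f(1) g(1) D(1) continuous_intros) (simp add: D_def algebra_simps)
      moreover have "0 \<le> L (\<lambda>x. f n x * D K x)" "0 \<le> L (\<lambda>x. f n x * g (Suc K) x)" for n
        by (intro L_nonneg continuous_intros mult_nonneg_nonneg f g D)+
      ultimately have "(\<Sum>n. ennreal (L (\<lambda>x. f n x * g K x)))
          = (\<Sum>n. ennreal (L (\<lambda>x. f n x * D K x)) + ennreal (L (\<lambda>x. f n x * g (Suc K) x)))"
        by simp
      also have "\<dots> = a K + (\<Sum>n. ennreal (L (\<lambda>x. f n x * g (Suc K) x)))"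
        unfolding a_def by (rule suminf_add[symmetric]) auto
      finally show ?case using Suc by (simp add: add.assoc)
    qed
    have "outer (A \<inter> C) \<le> (\<Sum>n. ennreal (L (\<lambda>x. f n x * g K x)))" for K
      using maj by (intro outer_le) (auto simp: majorant_def f g(3,5) intro!: continuous_intros g(1))
    then have "(\<Sum>k<K. a k) + outer (A \<inter> C) \<le> (\<Sum>n. ennreal (L (f n)))" for K
      unfolding split[of K, symmetric] by (intro add_left_mono)
    then have "(SUP K. (\<Sum>k<K. a k) + outer (A \<inter> C)) \<le> (\<Sum>n. ennreal (L (f n)))"
      by (intro SUP_least)
    then have le: "(\<Sum>k. a k) + outer (A \<inter> C) \<le> (\<Sum>n. ennreal (L (f n)))"
      unfolding suminf_eq_SUP[of a] by (subst ennreal_SUP_add_left[symmetric]) auto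
    have "majorant (\<lambda>m. case prod_decode m of (k, n) \<Rightarrow> (\<lambda>x. f n x * D k x)) (A - C)"
      unfolding majorant_def
    proof (intro conjI allI ballI)
      fix x assume x: "x \<in> A - C"
      have "(\<Sum>m. (\<lambda>(k, n). ennreal (f n x * D k x)) (prod_decode m))
          = (\<Sum>k. \<Sum>n. ennreal (f n x * D k x))"
        by (intro suminf_ennreal_2dimen) simp
      also have "\<dots> = (\<Sum>k. \<Sum>n. ennreal (f n x) * ennreal (D k x))"
        by (simp add: ennreal_mult f D)
      also have "\<dots> = (\<Sum>n. ennreal (f n x)) * (\<Sum>k. ennreal (D k x))"
        by (simp add: ennreal_suminf_multc ennreal_suminf_cmult)
      also have "\<dots> = (\<Sum>n. ennreal (f n x))" using sumD x by simp
      also have "1 \<le> \<dots>" using maj x by (auto simp: majorant_def)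
      finally show "1 \<le> (\<Sum>m. ennreal ((case prod_decode m of (k, n) \<Rightarrow> (\<lambda>x. f n x * D k x)) x))"
        by (simp add: case_prod_beta)
    qed (auto simp: f D intro!: continuous_intros split: prod.split)
    then have "outer (A - C) \<le> (\<Sum>m. ennreal (L (case prod_decode m of (k, n) \<Rightarrow> (\<lambda>x. f n x * D k x))))"
      by (rule outer_le)
    also have "\<dots> = (\<Sum>m. (\<lambda>(k, n). ennreal (L (\<lambda>x. f n x * D k x))) (prod_decode m))"
      by (simp add: case_prod_beta)
    also have "\<dots> = (\<Sum>k. a k)"
      by (intro suminf_ennreal_2dimen) (simp add: a_def)
    finally have "outer (A - C) + outer (A \<inter> C) \<le> (\<Sum>k. a k) + outer (A \<inter> C)"
      by (rule add_right_mono)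
    from order_trans[OF this le] show ?thesis by (simp only: add.commute)
  qed
  then show ?thesis
    unfolding outer_def[of A] by (intro INF_greatest) (simp only: mem_Collect_eq)
qed

section \<open>The representing measure and its integral\<close>

definition riesz :: "'a measure" where
  "riesz = measure_of UNIV (sets borel) outer"

lemma sets_riesz [simp]: "sets riesz = sets borel"
  unfolding riesz_def by (metis sets.sets_measure_of_eq space_borel)

lemma space_riesz [simp]: "space riesz = UNIV"
  using sets_eq_imp_space_eq[OF sets_riesz] by simp

text \<open>\<open>measure_of\<close> returns \<open>outer\<close> only if that is countably
  additive on the Borel sets. By the splitting inequality closed sets are Caratheodory measurable,
  hence so are all Borel sets.\<close>

lemma emeasure_riesz:
  assumes "A \<in> sets borel"
  shows "emeasure riesz A = outer A"
proof -
  let ?S = "lambda_system UNIV (Pow UNIV) outer"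
  interpret P: sigma_algebra UNIV "Pow UNIV :: 'a set set" by (rule sigma_algebra_Pow)
  have ms: "measure_space UNIV ?S outer"
    by (rule P.caratheodory_lemma[OF outer_measure_space_outer])
  then interpret S: sigma_algebra UNIV ?S by (simp add: measure_space_def)
  have closed: "C \<in> ?S" if "closed C" for C
  proof -
    have "outer (A \<inter> C) + outer (A - C) = outer A" for A
      using closed_outer_split[OF that, of A] outer_Un_le[of "A \<inter> C" "A - C"]
      by (intro antisym) (auto simp: Int_Diff_Un)
    then show ?thesis unfolding P.lambda_system_eq by simp
  qed
  have "U \<in> ?S" if "open U" for U
  proof -
    have "UNIV - (- U) \<in> ?S"
      by (rule S.compl_sets[OF closed]) (use that in \<open>simp add: closed_def\<close>)
    then show ?thesis by (simp add: Diff_eq)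
  qed
  then have sub: "sets borel \<subseteq> ?S"
    unfolding sets_borel by (intro S.sigma_sets_subset) auto
  show ?thesis
    unfolding riesz_def
  proof (rule emeasure_measure_of_sigma)
    show "sigma_algebra UNIV (sets (borel :: 'a measure))"
      using sets.sigma_algebra_axioms[of borel] by simp
    show "positive (sets borel) outer"
      by (simp add: positive_def outer_empty)
    show "countably_additive (sets borel) outer"
      using ms sub unfolding measure_space_def countably_additive_def by (meson order_trans subsetD)
  qed fact
qed

text \<open>The lower bound is Dini's argument: the open sets where a partial sum exceeds
  \<open>1 - e\<close> increase to the whole space, so one partial sum exceeds \<open>1 - e\<close>
  everywhere and positivity of \<open>L\<close> applies to it.\<close>

lemma outer_UNIV: "outer UNIV = 1"
proof (rule antisym)
  show "outer UNIV \<le> 1"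
    using outer_le_single[of "\<lambda>_. 1" UNIV] L_one by simp
  have "1 \<le> (\<Sum>n. ennreal (L (f n)))" if maj: "majorant f UNIV" for f
  proof (rule ennreal_le_epsilon)
    fix e :: real assume "0 < e"
    have f: "continuous_on UNIV (f n)" "0 \<le> f n x" for n x
      using maj by (auto simp: majorant_def)
    define U where "U N = {x. 1 - e < (\<Sum>n<N. f n x)}" for N
    obtain N where N: "U N = UNIV"
    proof (rule directed_open_cover[of U])
      show "open (U N)" for N
        unfolding U_def by (intro open_Collect_less continuous_intros f)
      show "incseq U"
      proof (rule incseq_SucI)
        show "U N \<subseteq> U (Suc N)" for N
          using f(2)[of N] by (auto simp: U_def intro: add_strict_increasing2 less_le_trans)
      qed
      have "\<exists>N. x \<in> U N" for x
      \<comment> \<open>For \<open>e \<ge> 1\<close> the threshold \<open>1 - e\<close> is not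
        positive and \<open>ennreal\<close> would truncate it, so one positive term is exhibited
        instead.\<close>
      proof (cases "e < 1")
        case True
        have "ennreal (1 - e) < 1" using \<open>0 < e\<close> by (simp add: ennreal_less_one_iff)
        also have "1 \<le> (SUP N. \<Sum>n<N. ennreal (f n x))"
          using maj unfolding majorant_def suminf_eq_SUP by blast
        finally have "\<exists>N\<in>UNIV. ennreal (1 - e) < (\<Sum>n<N. ennreal (f n x))"
          by (simp only: less_SUP_iff)
        then obtain N where "ennreal (1 - e) < (\<Sum>n<N. ennreal (f n x))"
          by blast
        then show ?thesis
          using f(2) True by (auto simp: U_def sum_ennreal ennreal_less_iff)
      next
        case False
        have "\<exists>n. f n x \<noteq> 0"
        proof (rule ccontr)
          assume "\<nexists>n. f n x \<noteq> 0"
          then have "(\<Sum>n. ennreal (f n x)) = 0" by simp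
          moreover have "1 \<le> (\<Sum>n. ennreal (f n x))"
            using maj unfolding majorant_def by blast
          ultimately show False by simp
        qed
        then obtain n where "f n x \<noteq> 0" by blast
        then have "0 < f n x" using f(2)[of n x] by simp
        also have "f n x \<le> (\<Sum>i<Suc n. f i x)"
          by (intro member_le_sum) (auto simp: f)
        finally have "x \<in> U (Suc n)" using False by (simp add: U_def)
        then show ?thesis by blast
      qed
      then show "(\<Union>N. U N) = UNIV" by auto
    qed blast
    have "1 - e = L (\<lambda>_. 1 - e)" by (simp add: L_const)
    also have "\<dots> \<le> L (\<lambda>x. \<Sum>n<N. f n x)"
      using N by (intro L_mono continuous_intros f) (auto simp: U_def intro: less_imp_le)
    also have "\<dots> = (\<Sum>n<N. L (f n))"
      by (rule L_sum[OF f(1)])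
    finally have "ennreal (1 - e) \<le> (\<Sum>n<N. ennreal (L (f n)))"
      using L_nonneg[OF f] by (simp add: sum_ennreal ennreal_leI)
    also have "\<dots> \<le> (\<Sum>n. ennreal (L (f n)))"
      by (intro sum_le_suminf) auto
    finally have "ennreal (1 - e) + ennreal e \<le> (\<Sum>n. ennreal (L (f n))) + ennreal e"
      by (rule add_right_mono)
    moreover have "1 \<le> ennreal (1 - e) + ennreal e"
    proof (cases "e \<le> 1")
      case True
      then show ?thesis using \<open>0 < e\<close> by (simp add: ennreal_plus[symmetric] del: ennreal_plus)
    next
      case False
      then have "1 \<le> ennreal e" by simp
      then show ?thesis by (simp add: add_increasing)
    qed
    ultimately show "1 \<le> (\<Sum>n. ennreal (L (f n))) + ennreal e" by order
  qed
  then show "1 \<le> outer UNIV"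
    unfolding outer_def by (intro INF_greatest) simp
qed

lemma prob_space_riesz: "prob_space riesz"
  by (rule prob_spaceI) (simp add: emeasure_riesz outer_UNIV)

lemma integrable_riesz:
  assumes "continuous_on UNIV f"
  shows "integrable riesz (f :: 'a \<Rightarrow> real)"
proof -
  interpret prob_space riesz by (rule prob_space_riesz)
  obtain b where "\<And>x. \<bar>f x\<bar> \<le> b" using continuous_bounded[OF assms] by metis
  moreover have "f \<in> borel_measurable riesz"
    using borel_measurable_continuous_onI[OF assms] by (simp cong: measurable_cong_sets)
  ultimately show ?thesis by (intro integrable_const_bound[of _ b]) auto
qed

text \<open>The layers of the layer-cake estimate: layer \<open>j\<close> lies between the
  indicators of \<open>y \<ge> j + 1\<close> and \<open>y \<ge> j\<close>.\<close>

lemma sum_clamp: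
  fixes y :: real
  shows "(\<Sum>j<(J::nat). min 1 (max 0 (y - real j))) = min (max 0 y) (real J)"
  by (induction J) (auto simp: min_def max_def)

lemma measure_riesz_le:
  assumes "continuous_on UNIV f" "\<And>x. 0 \<le> f x" "\<And>x. x \<in> A \<Longrightarrow> 1 \<le> f x" "A \<in> sets borel"
  shows "measure riesz A \<le> L f"
proof -
  have "emeasure riesz A \<le> ennreal (L f)"
    using outer_le_single[OF assms(1-3)] by (simp add: emeasure_riesz assms(4))
  then show ?thesis
    unfolding measure_def by (intro enn2real_leI L_nonneg assms)
qed

text \<open>Layer-cake estimate, with error bounded independently of \<open>f\<close>; the error disappears by scaling \<open>f\<close>.\<close>

lemma integral_riesz_le_add_1:
  assumes f: "continuous_on UNIV f" "\<And>x. 0 \<le> f x"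
  shows "integral\<^sup>L riesz f \<le> L f + 1"
proof -
  interpret prob_space riesz by (rule prob_space_riesz)
  obtain b where b: "\<And>x. \<bar>f x\<bar> \<le> b" using continuous_bounded[OF f(1)] by metis
  obtain J :: nat where J: "b \<le> real J" using real_arch_simple by blast
  define c where "c j x = min 1 (max 0 (f x - real j))" for j x
  define A where "A j = {x. real j \<le> f x}" for j
  have c: "continuous_on UNIV (c j)" "0 \<le> c j x" for j x
    by (auto simp: c_def[abs_def] intro!: continuous_intros f)
  have sum_c: "(\<Sum>j<K. c j x) = f x" if "J \<le> K" for K x
  proof -
    have "f x \<le> real K" using b[of x] J that by linarith
    then show ?thesis using f(2)[of x] by (simp add: c_def sum_clamp)
  qed
  have A: "A j \<in> sets borel" for j
    unfolding A_def by (intro borel_closed closed_Collect_le continuous_intros f)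
  have f_le: "f x \<le> (\<Sum>j<Suc J. indicator (A j) x)" for x
  proof -
    have "c j x \<le> indicator (A j) x" for j
      by (auto simp: c_def A_def indicator_def)
    then have "(\<Sum>j<Suc J. c j x) \<le> (\<Sum>j<Suc J. indicator (A j) x)"
      by (intro sum_mono)
    then show ?thesis using sum_c[of "Suc J" x] by simp
  qed
  have int: "integrable riesz (\<lambda>x. \<Sum>j<Suc J. indicator (A j) x :: real)"
    using A by (intro Bochner_Integration.integrable_sum integrable_real_indicator)
      (auto simp: emeasure_eq_measure)
  have "integral\<^sup>L riesz f \<le> integral\<^sup>L riesz (\<lambda>x. \<Sum>j<Suc J. indicator (A j) x)"
    by (rule integral_mono[OF integrable_riesz[OF f(1)] int f_le])
  also have "\<dots> = (\<Sum>j<Suc J. measure riesz (A j))"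
    using A by (subst Bochner_Integration.integral_sum) (auto simp: emeasure_eq_measure)
  \<comment> \<open>The shift pairs \<open>A (Suc j)\<close> with \<open>c j\<close>, which equals 1
    there; the unpaired level \<open>A 0\<close> costs the additive 1.\<close>
  also have "\<dots> = measure riesz (A 0) + (\<Sum>j<J. measure riesz (A (Suc j)))"
    by (rule sum.lessThan_Suc_shift)
  also have "\<dots> \<le> 1 + (\<Sum>j<J. L (c j))"
  proof (intro add_mono sum_mono measure_riesz_le c A)
    show "1 \<le> c j x" if "x \<in> A (Suc j)" for j x
      using that by (auto simp: c_def A_def)
  qed simp
  also have "(\<Sum>j<J. L (c j)) = L f"
    using L_sum[of c J] c(1) sum_c[of J] by simp
  finally show ?thesis by simp
qed

text \<open>Scaling by \<open>1 / e\<close> reduces the additive error to \<open>e\<close>. Adding a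
  bound of \<open>f\<close> then removes the nonnegativity assumption, and the inequality for
  \<open>- f\<close> is the converse one.\<close>

lemma integral_riesz:
  assumes f: "continuous_on UNIV f"
  shows "integral\<^sup>L riesz f = L f"
proof -
  interpret prob_space riesz by (rule prob_space_riesz)
  have nonneg_le: "integral\<^sup>L riesz f \<le> L f" if "continuous_on UNIV f" "\<And>x. 0 \<le> f x" for f
  proof (rule field_le_epsilon)
    fix e :: real assume "0 < e"
    have "integral\<^sup>L riesz (\<lambda>x. 1 / e * f x) \<le> L (\<lambda>x. 1 / e * f x) + 1"
      using that \<open>0 < e\<close> by (intro integral_riesz_le_add_1 continuous_intros) auto
    then have "1 / e * integral\<^sup>L riesz f \<le> 1 / e * L f + 1"
      by (simp only: L_scale[OF that(1)] integral_mult_right_zero)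
    then show "integral\<^sup>L riesz f \<le> L f + e"
      using \<open>0 < e\<close> by (simp add: field_simps)
  qed
  have le: "integral\<^sup>L riesz f \<le> L f" if f: "continuous_on UNIV f" for f
  proof -
    obtain b where b: "\<And>x. \<bar>f x\<bar> \<le> b" using continuous_bounded[OF f] by metis
    have "0 \<le> f x + b" for x using b[of x] by linarith
    then have "integral\<^sup>L riesz (\<lambda>x. f x + b) \<le> L (\<lambda>x. f x + b)"
      by (intro nonneg_le continuous_intros f)
    moreover have "L (\<lambda>x. f x + b) = L f + b"
      using L_add[OF f continuous_on_const, of b] by (simp add: L_const)
    moreover have "integral\<^sup>L riesz (\<lambda>x. f x + b) = integral\<^sup>L riesz f + b"
      using integrable_riesz[OF f] prob_space by simp
    ultimately show ?thesis by simp
  qed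
  have "integral\<^sup>L riesz (\<lambda>x. - 1 * f x) \<le> L (\<lambda>x. - 1 * f x)"
    by (intro le continuous_intros f)
  then have "- integral\<^sup>L riesz f \<le> - L f"
    by (simp only: L_scale[OF f] integral_mult_right_zero)
  with le[OF f] show ?thesis by simp
qed

end

section \<open>Borel probability measures\<close>

lemma borel_probsD:
  assumes "\<mu> \<in> borel_probs"
  shows "prob_space \<mu>" "sets \<mu> = sets borel" "space \<mu> = UNIV"
  using assms by (auto simp: borel_probs_def dest: sets_eq_imp_space_eq)

lemma borel_measurable_bcontfun:
  "\<mu> \<in> borel_probs \<Longrightarrow> apply_bcontfun (f :: 'a::topological_space \<Rightarrow>\<^sub>C real) \<in> borel_measurable \<mu>"
  using borel_measurable_continuous_onI[of "apply_bcontfun f"] borel_probsD(2)[of \<mu>]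
  by (simp cong: measurable_cong_sets)

lemma integrable_bcontfun:
  assumes "\<mu> \<in> borel_probs"
  shows "integrable \<mu> (apply_bcontfun (f :: 'a::topological_space \<Rightarrow>\<^sub>C real))"
proof -
  interpret prob_space \<mu> by (rule borel_probsD(1)[OF assms])
  show ?thesis
    using borel_measurable_bcontfun[OF assms] norm_bounded[of f]
    by (intro integrable_const_bound[of _ "norm f"]) auto
qed

lemma integral_bcontfun_linear:
  assumes "\<mu> \<in> borel_probs"
  shows "linear (\<lambda>f :: 'a::topological_space \<Rightarrow>\<^sub>C real. integral\<^sup>L \<mu> (apply_bcontfun f))"
  using integrable_bcontfun[OF assms] by (intro linearI) simp_all

lemma integral_bcontfun_near:
  fixes f :: "'a::topological_space \<Rightarrow>\<^sub>C real"
  assumes \<mu>: "\<mu> \<in> borel_probs" and U: "U \<in> sets borel" "measure \<mu> U = 1"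
    and near: "\<And>y. y \<in> U \<Longrightarrow> \<bar>f y - c\<bar> \<le> r"
  shows "\<bar>integral\<^sup>L \<mu> f - c\<bar> \<le> r"
proof -
  interpret prob_space \<mu> by (rule borel_probsD(1)[OF \<mu>])
  have "AE y in \<mu>. y \<in> U"
    using AE_in_set_eq_1[of U] U borel_probsD(2)[OF \<mu>] by simp
  then have "AE y in \<mu>. f y \<le> c + r" "AE y in \<mu>. c - r \<le> f y"
    by (eventually_elim, use near in \<open>fastforce simp: abs_le_iff\<close>)+
  then have "integral\<^sup>L \<mu> f \<le> integral\<^sup>L \<mu> (\<lambda>_. c + r)" "integral\<^sup>L \<mu> (\<lambda>_. c - r) \<le> integral\<^sup>L \<mu> f"
    using integral_mono_AE[OF integrable_bcontfun[OF \<mu>] integrable_const]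
      integral_mono_AE[OF integrable_const integrable_bcontfun[OF \<mu>]] by blast+
  then show ?thesis by (simp add: prob_space abs_le_iff)
qed

section \<open>Mixtures, images and conditional measures\<close>

lemma nn_integral_mixture:
  assumes \<mu>: "\<mu> \<in> borel_probs" and \<nu>: "\<nu> \<in> borel_probs" and f: "f \<in> borel_measurable borel"
  shows "(\<integral>\<^sup>+x. f x \<partial>mixture t \<mu> \<nu>)
    = ennreal t * (\<integral>\<^sup>+x. f x \<partial>\<mu>) + ennreal (1 - t) * (\<integral>\<^sup>+x. f x \<partial>\<nu>)"
  using f
proof (induction f rule: borel_measurable_induct)
  case (cong f g)
  then have "f = g" by (auto simp: fun_eq_iff)
  then show ?case using cong by simp
next
  case (set A)
  then show ?case
    by (simp add: emeasure_mixture[OF \<mu> \<nu>] borel_probsD(2)[OF \<mu>] borel_probsD(2)[OF \<nu>])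
next
  case (mult u c)
  note [measurable_cong] = sets_mixture[of t \<mu> \<nu>] borel_probsD(2)[OF \<mu>] borel_probsD(2)[OF \<nu>]
  have [measurable]: "u \<in> borel_measurable borel" by fact
  show ?case
    by (simp add: nn_integral_cmult mult(4) distrib_left ac_simps)
next
  case (add u v)
  note [measurable_cong] = sets_mixture[of t \<mu> \<nu>] borel_probsD(2)[OF \<mu>] borel_probsD(2)[OF \<nu>]
  have [measurable]: "u \<in> borel_measurable borel" "v \<in> borel_measurable borel" by fact+
  show ?case
    by (subst (1 2 3) nn_integral_add) (simp_all add: add distrib_left ac_simps)
next
  case (seq U)
  note [measurable_cong] = sets_mixture[of t \<mu> \<nu>] borel_probsD(2)[OF \<mu>] borel_probsD(2)[OF \<nu>]
  have [measurable]: "U i \<in> borel_measurable borel" for i by fact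
  have SUP: "(\<integral>\<^sup>+x. (SUP i. U i) x \<partial>M) = (SUP i. \<integral>\<^sup>+x. U i x \<partial>M)" if [measurable_cong]: "sets M = sets borel" for M
    using nn_integral_monotone_convergence_SUP[OF \<open>incseq U\<close>, of M] by (simp add: image_comp)
  have inc: "incseq (\<lambda>i. \<integral>\<^sup>+x. U i x \<partial>M)" for M :: "'a measure"
    using \<open>incseq U\<close> by (auto simp: incseq_def le_fun_def intro: nn_integral_mono)
  show ?case
    by (simp only: SUP[OF sets_mixture] SUP[OF borel_probsD(2)[OF \<mu>]] SUP[OF borel_probsD(2)[OF \<nu>]]
        seq SUP_mult_left_ennreal)
      (intro ennreal_SUP_add, use inc in \<open>auto simp: incseq_def intro: mult_left_mono\<close>)
qed

lemma integral_mixture: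
  assumes \<mu>: "\<mu> \<in> borel_probs" and \<nu>: "\<nu> \<in> borel_probs" and t: "0 \<le> t" "t \<le> 1"
  shows "integral\<^sup>L (mixture t \<mu> \<nu>) (apply_bcontfun (f :: 'a::topological_space \<Rightarrow>\<^sub>C real))
    = t * integral\<^sup>L \<mu> f + (1 - t) * integral\<^sup>L \<nu> f"
proof -
  let ?b = "norm f"
  \<comment> \<open>Shifting by the norm makes the integrand nonnegative, so that the formula for
    nonnegative integrals applies.\<close>
  define h where "h x = apply_bcontfun f x + ?b" for x
  have nonneg: "0 \<le> h x" for x
    using norm_bounded[of f x] by (simp add: h_def)
  have h_borel: "h \<in> borel_measurable borel"
    unfolding h_def by (intro borel_measurable_continuous_onI continuous_intros) auto
  have h: "integral\<^sup>L M h = integral\<^sup>L M f + ?b" "integrable M h" if "M \<in> borel_probs" for M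
  proof -
    interpret M: prob_space M by (rule borel_probsD(1)[OF that])
    show "integral\<^sup>L M h = integral\<^sup>L M f + ?b" "integrable M h"
      unfolding h_def using integrable_bcontfun[OF that] by (simp_all add: M.prob_space)
  qed
  have nn: "(\<integral>\<^sup>+x. ennreal (h x) \<partial>M) = ennreal (integral\<^sup>L M h)" if "M \<in> borel_probs" for M
    by (rule nn_integral_eq_integral[OF h(2)[OF that]]) (simp add: nonneg)
  have int_nonneg: "0 \<le> integral\<^sup>L M h" for M
    by (simp add: nonneg)
  have "ennreal (integral\<^sup>L (mixture t \<mu> \<nu>) h) = ennreal (t * integral\<^sup>L \<mu> h + (1 - t) * integral\<^sup>L \<nu> h)"
    using nn_integral_mixture[OF \<mu> \<nu>, of "\<lambda>x. ennreal (h x)" t] h_borel t int_nonneg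
    by (simp add: nn[OF \<mu>] nn[OF \<nu>] nn[OF mixture_in_borel_probs[OF \<mu> \<nu> t]] ennreal_mult ennreal_plus)
  then have "integral\<^sup>L (mixture t \<mu> \<nu>) h = t * integral\<^sup>L \<mu> h + (1 - t) * integral\<^sup>L \<nu> h"
    using t int_nonneg by (subst (asm) ennreal_inj) auto
  then show ?thesis
    by (simp add: h(1)[OF \<mu>] h(1)[OF \<nu>] h(1)[OF mixture_in_borel_probs[OF \<mu> \<nu> t]] algebra_simps)
qed

lemma push_in_borel_probs:
  assumes "continuous_on UNIV T" "\<mu> \<in> borel_probs"
  shows "push T \<mu> \<in> borel_probs"
proof -
  interpret prob_space \<mu> by (rule borel_probsD(1)[OF assms(2)])
  have "T \<in> borel_measurable \<mu>"
    using borel_measurable_continuous_onI[OF assms(1)] borel_probsD(2)[OF assms(2)]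
    by (simp cong: measurable_cong_sets)
  then show ?thesis
    by (simp add: borel_probs_def push_def prob_space_distr)
qed

lemma integral_push:
  assumes "continuous_on UNIV T" "\<mu> \<in> borel_probs"
  shows "integral\<^sup>L (push T \<mu>) (apply_bcontfun (f :: 'a::topological_space \<Rightarrow>\<^sub>C real))
    = integral\<^sup>L \<mu> (\<lambda>x. f (T x))"
  unfolding push_def
  using borel_measurable_continuous_onI[OF assms(1)] borel_probsD(2)[OF assms(2)]
  by (intro integral_distr borel_measurable_continuous_onI) (simp_all cong: measurable_cong_sets)

lemma emeasure_push:
  assumes "continuous_on UNIV T" "\<mu> \<in> borel_probs" "A \<in> sets borel"
  shows "emeasure (push T \<mu>) A = emeasure \<mu> (T -` A)"
proof -
  have "T \<in> borel_measurable \<mu>"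
    using borel_measurable_continuous_onI[OF assms(1)] borel_probsD(2)[OF assms(2)]
    by (simp cong: measurable_cong_sets)
  then show ?thesis
    unfolding push_def using assms(3) by (simp add: emeasure_distr borel_probsD(3)[OF assms(2)])
qed

lemma vimage_borel:
  "continuous_on UNIV T \<Longrightarrow> A \<in> sets borel \<Longrightarrow> T -` A \<in> sets (borel :: 'a::topological_space measure)"
  using measurable_sets[OF borel_measurable_continuous_onI, of T A] by simp

lemma return_in_borel_probs: "return borel x \<in> borel_probs"
  by (simp add: borel_probs_def prob_space_return)

lemma integral_return_bcontfun:
  "integral\<^sup>L (return borel x) (apply_bcontfun (f :: 'a::topological_space \<Rightarrow>\<^sub>C real)) = f x"
  by (rule integral_return) (auto intro: borel_measurable_continuous_onI)

lemma uniform_measure_in_borel_probs: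
  assumes "\<mu> \<in> borel_probs" "0 < measure \<mu> B"
  shows "uniform_measure \<mu> B \<in> borel_probs"
proof -
  interpret prob_space \<mu> by (rule borel_probsD(1)[OF assms(1)])
  show ?thesis
    using assms by (auto simp: borel_probs_def emeasure_eq_measure intro!: prob_space_uniform_measure)
qed

text \<open>The law of total probability, in the form that lets affine functions be computed from
  conditional measures and shows that a measure charging both \<open>B\<close> and its complement is
  a proper mixture.\<close>

lemma mixture_uniform_measure:
  assumes \<mu>: "\<mu> \<in> borel_probs" and B: "B \<in> sets borel" "0 < measure \<mu> B" "measure \<mu> B < 1"
  shows "0 < measure \<mu> (- B)"
    and "mixture (measure \<mu> B) (uniform_measure \<mu> B) (uniform_measure \<mu> (- B)) = \<mu>"
proof -
  interpret prob_space \<mu> by (rule borel_probsD(1)[OF \<mu>])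
  note [simp] = borel_probsD(2,3)[OF \<mu>]
  have compl: "measure \<mu> (- B) = 1 - measure \<mu> B"
    using prob_compl[of B] B by (simp add: Compl_eq_Diff_UNIV)
  with B show "0 < measure \<mu> (- B)" by simp
  note probs = uniform_measure_in_borel_probs[OF \<mu> B(2)] uniform_measure_in_borel_probs[OF \<mu> this]
  show "mixture (measure \<mu> B) (uniform_measure \<mu> B) (uniform_measure \<mu> (- B)) = \<mu>"
  proof (rule measure_eqI)
    fix A assume "A \<in> sets (mixture (measure \<mu> B) (uniform_measure \<mu> B) (uniform_measure \<mu> (- B)))"
    then have A: "A \<in> sets borel" by simp
    have "emeasure \<mu> A = emeasure \<mu> (B \<inter> A) + emeasure \<mu> (- B \<inter> A)"
      using A B by (subst plus_emeasure) (auto intro: arg_cong2[where f = emeasure])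
    moreover have "ennreal c * (emeasure \<mu> S / ennreal c) = emeasure \<mu> S" if "0 < c" for c S
      using that by (simp add: emeasure_eq_measure divide_ennreal ennreal_mult[symmetric])
    ultimately show "emeasure (mixture (measure \<mu> B) (uniform_measure \<mu> B) (uniform_measure \<mu> (- B))) A
        = emeasure \<mu> A"
      using A B compl by (simp add: emeasure_mixture[OF probs] emeasure_eq_measure[of B]
          emeasure_eq_measure[of "- B"])
  qed simp
qed

lemma push_uniform_measure:
  assumes T: "continuous_on UNIV T" and \<mu>: "\<mu> \<in> borel_probs" "push T \<mu> = \<mu>"
    and B: "B \<in> sets borel" "T -` B = B" "0 < measure \<mu> B"
  shows "push T (uniform_measure \<mu> B) = uniform_measure \<mu> B"
proof (rule measure_eqI)
  note [simp] = borel_probsD(2)[OF \<mu>(1)]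
  note probs = uniform_measure_in_borel_probs[OF \<mu>(1) B(3)]
  show "sets (push T (uniform_measure \<mu> B)) = sets (uniform_measure \<mu> B)"
    by (simp add: push_def)
  fix A assume "A \<in> sets (push T (uniform_measure \<mu> B))"
  then have A: "A \<in> sets borel" by (simp add: push_def)
  have "emeasure \<mu> (B \<inter> T -` A) = emeasure (push T \<mu>) (B \<inter> A)"
    using A B by (subst emeasure_push[OF T \<mu>(1)]) auto
  then show "emeasure (push T (uniform_measure \<mu> B)) A = emeasure (uniform_measure \<mu> B) A"
    using A B vimage_borel[OF T A] by (simp add: emeasure_push[OF T probs] \<mu>(2))
qed

section \<open>Continuous functions determine Borel measures\<close>

context compact_metrizable
begin

text \<open>Dominated convergence along functions decreasing to an indicator handles closed sets,
  which form an intersection-stable generator of the Borel sets; a Dynkin argument does the rest.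
  Coefficients 1 and -1 give uniqueness of the representing measure, general ones the independence
  of ergodic measures.\<close>

lemma signed_combination_eq_0:
  fixes \<mu> :: "'j \<Rightarrow> 'a measure"
  assumes J: "finite J" and \<mu>: "\<And>j. j \<in> J \<Longrightarrow> \<mu> j \<in> borel_probs"
    and zero: "\<And>g :: 'a \<Rightarrow>\<^sub>C real. (\<Sum>j\<in>J. a j * integral\<^sup>L (\<mu> j) g) = 0"
    and B: "B \<in> sets borel"
  shows "(\<Sum>j\<in>J. a j * measure (\<mu> j) B) = 0"
proof -
  have closed: "(\<Sum>j\<in>J. a j * measure (\<mu> j) C) = 0" if "closed C" for C
  proof (rule closed_indicator_decreasing_limit[OF that])
    fix g :: "nat \<Rightarrow> 'a \<Rightarrow> real"
    assume g: "\<And>k. continuous_on UNIV (g k)" "\<And>x. g 0 x = 1" "\<And>k x. 0 \<le> g k x"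
      "\<And>k x. g (Suc k) x \<le> g k x" "\<And>k x. x \<in> C \<Longrightarrow> g k x = 1"
      "\<And>x. (\<lambda>k. g k x) \<longlonglongrightarrow> indicator C x"
    have le1: "g k x \<le> 1" for k x
      by (induction k) (auto simp: g(2) intro: order_trans[OF g(4)])
    have lim: "(\<lambda>k. integral\<^sup>L (\<mu> j) (g k)) \<longlonglongrightarrow> measure (\<mu> j) C" if "j \<in> J" for j
    proof -
      interpret prob_space "\<mu> j" by (rule borel_probsD(1)[OF \<mu>[OF that]])
      note [simp] = borel_probsD(2,3)[OF \<mu>[OF that]]
      have C: "C \<in> sets (\<mu> j)" using \<open>closed C\<close> by simp
      have "(\<lambda>k. integral\<^sup>L (\<mu> j) (g k)) \<longlonglongrightarrow> integral\<^sup>L (\<mu> j) (indicator C :: 'a \<Rightarrow> real)"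
      proof (rule integral_dominated_convergence[where w = "\<lambda>_. 1"])
        show "(indicator C :: 'a \<Rightarrow> real) \<in> borel_measurable (\<mu> j)"
          using C by (rule borel_measurable_indicator)
        show "g k \<in> borel_measurable (\<mu> j)" for k
          using borel_measurable_continuous_onI[OF g(1)] by (simp cong: measurable_cong_sets)
        show "AE x in \<mu> j. (\<lambda>k. g k x) \<longlonglongrightarrow> indicator C x"
          by (intro AE_I2 g(6))
        show "AE x in \<mu> j. norm (g k x) \<le> 1" for k
          by (intro AE_I2) (simp add: g(3) le1)
      qed simp
      then show ?thesis by simp
    qed
    have "(\<Sum>j\<in>J. a j * integral\<^sup>L (\<mu> j) (g k)) = 0" for k
    proof -
      have "g k \<in> bcontfun"
        by (rule bcontfun_normI[OF g(1), of _ 1]) (simp add: g(3) le1)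
      then show ?thesis using zero[of "Bcontfun (g k)"] by (simp add: Bcontfun_inverse)
    qed
    then have "(\<lambda>_::nat. 0) \<longlonglongrightarrow> (\<Sum>j\<in>J. a j * measure (\<mu> j) C)"
      using tendsto_sum[of J "\<lambda>j k. a j * integral\<^sup>L (\<mu> j) (g k)" "\<lambda>j. a j * measure (\<mu> j) C" sequentially]
        tendsto_mult_left[OF lim] by simp
    then show ?thesis using LIMSEQ_unique tendsto_const by metis
  qed
  have B': "B \<in> sigma_sets UNIV (Collect closed)"
    using B by (simp add: borel_eq_closed)
  have Int: "Int_stable (Collect closed :: 'a set set)"
    by (auto simp: Int_stable_def)
  \<comment> \<open>Total mass 0, read off from the whole space, is what gives closure under
    complements.\<close>
  have total: "(\<Sum>j\<in>J. a j) = 0"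
  proof -
    have "measure (\<mu> j) UNIV = 1" if "j \<in> J" for j
      using prob_space.prob_space[OF borel_probsD(1)[OF \<mu>[OF that]]] borel_probsD(3)[OF \<mu>[OF that]]
      by simp
    then show ?thesis using closed[OF closed_UNIV] by simp
  qed
  show ?thesis
  proof (rule sigma_sets_induct_disjoint[OF Int _ B'])
    show "(\<Sum>j\<in>J. a j * measure (\<mu> j) C) = 0" if "C \<in> Collect closed" for C
      using that closed by simp
    show "(\<Sum>j\<in>J. a j * measure (\<mu> j) (UNIV - A)) = 0"
      if A: "A \<in> sigma_sets UNIV (Collect closed)" and eq: "(\<Sum>j\<in>J. a j * measure (\<mu> j) A) = 0" for A
    proof -
      have "A \<in> sets borel" using A by (simp add: borel_eq_closed)
      then have "measure (\<mu> j) (UNIV - A) = 1 - measure (\<mu> j) A" if "j \<in> J" for j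
        using prob_space.prob_compl[OF borel_probsD(1)[OF \<mu>[OF that]], of A] borel_probsD(2,3)[OF \<mu>[OF that]]
        by simp
      then have "(\<Sum>j\<in>J. a j * measure (\<mu> j) (UNIV - A)) = (\<Sum>j\<in>J. a j - a j * measure (\<mu> j) A)"
        by (intro sum.cong) (simp_all add: right_diff_distrib)
      then show ?thesis
        using total eq by (simp add: sum_subtractf)
    qed
    show "(\<Sum>j\<in>J. a j * measure (\<mu> j) (\<Union>i. A i)) = 0"
      if disj: "disjoint_family A" and A: "range A \<subseteq> sigma_sets UNIV (Collect closed)"
        and eq: "\<And>i. (\<Sum>j\<in>J. a j * measure (\<mu> j) (A i)) = 0" for A :: "nat \<Rightarrow> 'a set"
    proof -
      have "(\<lambda>i. measure (\<mu> j) (A i)) sums measure (\<mu> j) (\<Union>i. A i)" if "j \<in> J" for j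
        using prob_space.finite_measure[OF borel_probsD(1)[OF \<mu>[OF that]]] A disj
        by (intro finite_measure.finite_measure_UNION)
          (auto simp: borel_probsD(2)[OF \<mu>[OF that]] borel_eq_closed)
      then have "(\<lambda>i. \<Sum>j\<in>J. a j * measure (\<mu> j) (A i)) sums (\<Sum>j\<in>J. a j * measure (\<mu> j) (\<Union>i. A i))"
        by (intro sums_sum sums_mult)
      then show ?thesis
        using sums_unique2[OF sums_zero] by (simp add: eq)
    qed
  qed simp_all
qed

lemma borel_probs_eqI:
  assumes \<mu>: "(\<mu> :: 'a measure) \<in> borel_probs" and \<nu>: "\<nu> \<in> borel_probs"
    and eq: "\<And>g :: 'a \<Rightarrow>\<^sub>C real. integral\<^sup>L \<mu> g = integral\<^sup>L \<nu> g"
  shows "\<mu> = \<nu>"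
proof (rule measure_eqI)
  interpret M: prob_space \<mu> by (rule borel_probsD(1)[OF \<mu>])
  interpret N: prob_space \<nu> by (rule borel_probsD(1)[OF \<nu>])
  show "sets \<mu> = sets \<nu>" by (simp add: borel_probsD(2)[OF \<mu>] borel_probsD(2)[OF \<nu>])
  fix A assume "A \<in> sets \<mu>"
  then have "A \<in> sets borel" by (simp add: borel_probsD(2)[OF \<mu>])
  then have "(\<Sum>j\<in>{True, False}. (if j then 1 else - 1) * measure (if j then \<mu> else \<nu>) A) = 0"
    using \<mu> \<nu> eq by (intro signed_combination_eq_0) auto
  then show "emeasure \<mu> A = emeasure \<nu> A"
    by (simp add: M.emeasure_eq_measure N.emeasure_eq_measure)
qed

end

section \<open>Affine functions of measures\<close>

context compact_metrizable
begin

text \<open>A basic weak-* neighbourhood of the Dirac mass restricts only finitely many integrals.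
  Let \<open>U\<close> be the points at which these finitely many functions are close to their
  values at \<open>x\<close>; a measure carried by \<open>U\<close> then satisfies all the
  restrictions.\<close>

lemma weak_star_continuous_near_return:
  fixes \<psi> :: "'a measure \<Rightarrow> real"
  assumes \<psi>: "continuous_map weak_star_topology euclideanreal \<psi>" and "0 < e"
  obtains U where "open U" "x \<in> U"
    "\<And>\<mu>. \<mu> \<in> borel_probs \<Longrightarrow> measure \<mu> U = 1 \<Longrightarrow> \<bar>\<psi> \<mu> - \<psi> (return borel x)\<bar> < e"
proof -
  let ?\<delta> = "return borel x :: 'a measure"
  let ?ev = "\<lambda>\<mu> (f :: 'a \<Rightarrow>\<^sub>C real). integral\<^sup>L \<mu> (apply_bcontfun f)"
  have "openin weak_star_topology {\<mu> \<in> topspace weak_star_topology. \<psi> \<mu> \<in> ball (\<psi> ?\<delta>) e}"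
    by (rule openin_continuous_map_preimage[OF \<psi>]) simp
  then obtain W where W: "openin (product_topology (\<lambda>_. euclideanreal) UNIV) W"
    and V: "{\<mu> \<in> borel_probs. \<psi> \<mu> \<in> ball (\<psi> ?\<delta>) e} = ?ev -` W \<inter> borel_probs"
    unfolding topspace_weak_star_topology unfolding weak_star_topology_def openin_pullback_topology
    by blast
  have "?\<delta> \<in> {\<mu> \<in> borel_probs. \<psi> \<mu> \<in> ball (\<psi> ?\<delta>) e}"
    using \<open>0 < e\<close> by (simp add: return_in_borel_probs)
  then have in_W: "?ev ?\<delta> \<in> W" using V by blast
  then obtain X where X: "?ev ?\<delta> \<in> (\<Pi>\<^sub>E i\<in>UNIV. X i)" "\<And>i. open (X i)"
    "finite {i. X i \<noteq> UNIV}" "(\<Pi>\<^sub>E i\<in>UNIV. X i) \<subseteq> W"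
    using product_topology_open_contains_basis[OF W in_W] by auto
  \<comment> \<open>Closed balls, because the integral estimate only gives a non-strict
    bound.\<close>
  have "\<exists>r>0. cball (f x) r \<subseteq> X f" for f :: "'a \<Rightarrow>\<^sub>C real"
    using X(1) X(2)[of f] by (auto simp: PiE_iff integral_return_bcontfun open_contains_cball)
  then obtain r where r: "\<And>f. 0 < r f" "\<And>f. cball (apply_bcontfun f x) (r f) \<subseteq> X f"
    by metis
  define U where "U = (\<Inter>f\<in>{i. X i \<noteq> UNIV}. {y. \<bar>apply_bcontfun f y - f x\<bar> < r f})"
  show ?thesis
  proof (rule that)
    show U: "open U"
      unfolding U_def
      by (intro open_INT X(3) ballI open_Collect_less continuous_intros) auto
    show "x \<in> U" using r(1) by (simp add: U_def)
    fix \<mu> :: "'a measure" assume \<mu>: "\<mu> \<in> borel_probs" "measure \<mu> U = 1"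
    have "?ev \<mu> f \<in> X f" for f :: "'a \<Rightarrow>\<^sub>C real"
    proof (cases "X f = UNIV")
      case False
      then have "\<bar>?ev \<mu> f - f x\<bar> \<le> r f"
        using U \<mu> by (intro integral_bcontfun_near) (auto simp: U_def intro: less_imp_le)
      then show ?thesis using r(2)[of f] by (auto simp: dist_real_def abs_minus_commute)
    qed simp
    then have "?ev \<mu> \<in> W" using X(4) by (auto simp: PiE_iff)
    then show "\<bar>\<psi> \<mu> - \<psi> ?\<delta>\<bar> < e"
      using V \<mu>(1) by (auto simp: dist_real_def abs_minus_commute)
  qed
qed

text \<open>On measures carried by a small neighbourhood of \<open>x\<close> both sides are close to \<open>\<psi>\<close> at the Dirac
  mass at \<open>x\<close>; by compactness, decomposing a measure into conditional measures on finitely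
  many such neighbourhoods gives the general case.\<close>

lemma affine_continuous_represented:
  fixes \<psi> :: "'a measure \<Rightarrow> real"
  assumes \<psi>: "continuous_map weak_star_topology euclideanreal \<psi>"
    and affine: "\<And>\<mu> \<nu> t. \<mu> \<in> borel_probs \<Longrightarrow> \<nu> \<in> borel_probs \<Longrightarrow> 0 \<le> t \<Longrightarrow> t \<le> 1 \<Longrightarrow>
      \<psi> (mixture t \<mu> \<nu>) = t * \<psi> \<mu> + (1 - t) * \<psi> \<nu>"
  obtains f :: "'a \<Rightarrow>\<^sub>C real" where "\<And>\<mu>. \<mu> \<in> borel_probs \<Longrightarrow> \<psi> \<mu> = integral\<^sup>L \<mu> f"
proof -
  define g where "g x = \<psi> (return borel x)" for x :: 'a
  have near: "\<exists>U. open U \<and> x \<in> U \<and> (\<forall>\<mu>\<in>borel_probs. measure \<mu> U = 1 \<longrightarrow> \<bar>\<psi> \<mu> - g x\<bar> < e)"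
    if "0 < e" for x e
    unfolding g_def by (rule weak_star_continuous_near_return[OF \<psi> that, of x]) blast
  have return_U: "measure (return borel y) U = 1" if "open U" "y \<in> U" for y :: 'a and U
    using that by (simp add: measure_return)
  have "continuous_on UNIV g"
    unfolding continuous_on_topological
  proof (intro ballI allI impI)
    fix x B assume "open B" "g x \<in> B"
    then obtain e where e: "0 < e" "ball (g x) e \<subseteq> B" by (auto simp: open_contains_ball)
    obtain U where U: "open U" "x \<in> U"
      "\<And>\<mu>. \<mu> \<in> borel_probs \<Longrightarrow> measure \<mu> U = 1 \<Longrightarrow> \<bar>\<psi> \<mu> - g x\<bar> < e"
      using near[OF e(1), of x] by blast
    have "g y \<in> B" if "y \<in> U" for y
      using U(3)[OF return_in_borel_probs return_U[OF U(1) that]] e(2)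
      by (auto simp: g_def dist_real_def abs_minus_commute)
    then show "\<exists>A. open A \<and> x \<in> A \<and> (\<forall>y\<in>UNIV. y \<in> A \<longrightarrow> g y \<in> B)"
      using U by blast
  qed
  moreover then obtain b where "\<And>x. \<bar>g x\<bar> \<le> b" using continuous_bounded by metis
  ultimately have "g \<in> bcontfun" by (intro bcontfun_normI) auto
  then obtain f where f: "apply_bcontfun f = g" using Bcontfun_inverse by metis
  have "\<psi> \<mu> = integral\<^sup>L \<mu> f" if "\<mu> \<in> borel_probs" for \<mu>
  proof -
    have "\<bar>\<psi> \<mu> - integral\<^sup>L \<mu> f\<bar> \<le> e" if "0 < e" for e
    proof -
      define good where "good B \<longleftrightarrow> B \<in> sets borel \<and>
        (\<forall>\<mu>\<in>borel_probs. measure \<mu> B = 1 \<longrightarrow> \<bar>\<psi> \<mu> - integral\<^sup>L \<mu> f\<bar> \<le> e)" for B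
      \<comment> \<open>One half for comparing \<open>\<psi> \<mu>\<close> with \<open>g x\<close>,
        the other for comparing the integral with \<open>g x\<close>.\<close>
      have "0 < e / 2" using that by simp
      then obtain U where U: "\<And>x. open (U x)" "\<And>x. x \<in> U x"
        "\<And>x \<mu>. \<mu> \<in> borel_probs \<Longrightarrow> measure \<mu> (U x) = 1 \<Longrightarrow> \<bar>\<psi> \<mu> - g x\<bar> < e / 2"
        using near by metis
      have good_U: "good (U x)" for x
        unfolding good_def
      proof (intro conjI ballI impI)
        show "U x \<in> sets borel" using U(1) by simp
        fix \<mu> :: "'a measure" assume \<mu>: "\<mu> \<in> borel_probs" "measure \<mu> (U x) = 1"
        have "\<bar>integral\<^sup>L \<mu> f - g x\<bar> \<le> e / 2"
        proof (rule integral_bcontfun_near[OF \<mu>(1) _ \<mu>(2)])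
          show "U x \<in> sets borel" using U(1) by simp
          show "\<bar>f y - g x\<bar> \<le> e / 2" if "y \<in> U x" for y
            using U(3)[OF return_in_borel_probs return_U[OF U(1) that]] by (simp add: f g_def)
        qed
        then show "\<bar>\<psi> \<mu> - integral\<^sup>L \<mu> f\<bar> \<le> e"
          using U(3)[OF \<mu>] by linarith
      qed
      \<comment> \<open>Conditioning on \<open>A\<close> and on its complement gives measures
        carried by \<open>A\<close> and by \<open>B\<close>. Both sides are affine, so the error is
        a convex combination of two errors and does not grow with the number of
        neighbourhoods.\<close>
      have good_Un: "good (A \<union> B)" if A: "good A" and B: "good B" for A B
        unfolding good_def
      proof (intro conjI ballI impI)
        have sets: "A \<in> sets borel" "B \<in> sets borel" using A B by (auto simp: good_def)
        then show "A \<union> B \<in> sets borel" by simp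
        fix \<mu> :: "'a measure" assume \<mu>: "\<mu> \<in> borel_probs" "measure \<mu> (A \<union> B) = 1"
        interpret prob_space \<mu> by (rule borel_probsD(1)[OF \<mu>(1)])
        note [simp] = borel_probsD(2,3)[OF \<mu>(1)]
        let ?p = "measure \<mu> A"
        consider "?p = 1" | "?p = 0" | "0 < ?p" "?p < 1"
          using prob_le_1[of A] zero_less_measure_iff[of \<mu> A] by linarith
        then show "\<bar>\<psi> \<mu> - integral\<^sup>L \<mu> f\<bar> \<le> e"
        proof cases
          case 1
          then show ?thesis using A \<mu> by (simp add: good_def)
        next
          case 2
          then have "measure \<mu> B = 1"
            using \<mu>(2) measure_Un_le[of A \<mu> B] prob_le_1[of B] sets by simp
          then show ?thesis using B \<mu> by (simp add: good_def)
        next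
          case 3
          note mix = mixture_uniform_measure[OF \<mu>(1) sets(1) 3]
          note probs = uniform_measure_in_borel_probs[OF \<mu>(1) 3(1)]
            uniform_measure_in_borel_probs[OF \<mu>(1) mix(1)]
          have "measure \<mu> (A \<union> (- A \<inter> B)) = measure \<mu> A + measure \<mu> (- A \<inter> B)"
            using sets by (intro finite_measure_Union) auto
          moreover have "A \<union> (- A \<inter> B) = A \<union> B" by auto
          moreover have "measure \<mu> (- A) = 1 - measure \<mu> A"
            using prob_compl[of A] sets by (simp add: Compl_eq_Diff_UNIV)
          ultimately have "measure \<mu> (- A \<inter> B) = measure \<mu> (- A)"
            using \<mu>(2) by simp
          then have "measure (uniform_measure \<mu> A) A = 1" "measure (uniform_measure \<mu> (- A)) B = 1"
            using 3 mix(1) sets by (simp_all add: emeasure_eq_measure)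
          then have bounds: "\<bar>\<psi> (uniform_measure \<mu> A) - integral\<^sup>L (uniform_measure \<mu> A) f\<bar> \<le> e"
            "\<bar>\<psi> (uniform_measure \<mu> (- A)) - integral\<^sup>L (uniform_measure \<mu> (- A)) f\<bar> \<le> e"
            using A B probs by (auto simp: good_def)
          have "\<psi> \<mu> = ?p * \<psi> (uniform_measure \<mu> A) + (1 - ?p) * \<psi> (uniform_measure \<mu> (- A))"
            using affine[OF probs, of ?p] 3 mix(2) by simp
          moreover have "integral\<^sup>L \<mu> f
              = ?p * integral\<^sup>L (uniform_measure \<mu> A) f + (1 - ?p) * integral\<^sup>L (uniform_measure \<mu> (- A)) f"
            using integral_mixture[OF probs, of ?p f] 3 mix(2) by simp
          ultimately have "\<psi> \<mu> - integral\<^sup>L \<mu> f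
              = ?p * (\<psi> (uniform_measure \<mu> A) - integral\<^sup>L (uniform_measure \<mu> A) f)
                + (1 - ?p) * (\<psi> (uniform_measure \<mu> (- A)) - integral\<^sup>L (uniform_measure \<mu> (- A)) f)"
            by (simp add: algebra_simps)
          also have "\<bar>\<dots>\<bar> \<le> e"
            using convex_bound_le[of "\<bar>\<psi> (uniform_measure \<mu> A) - integral\<^sup>L (uniform_measure \<mu> A) f\<bar>" e
                "\<bar>\<psi> (uniform_measure \<mu> (- A)) - integral\<^sup>L (uniform_measure \<mu> (- A)) f\<bar>" ?p "1 - ?p"]
              bounds 3 by (intro order_trans[OF abs_triangle_ineq]) (simp add: abs_mult)
          finally show ?thesis .
        qed
      qed
      have good_finite: "good (\<Union>x\<in>C. U x)" if "finite C" for C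
        using that
      proof (induction C rule: finite_induct)
        case empty
        then show ?case by (simp add: good_def)
      next
        case (insert x C)
        then show ?case using good_Un[OF good_U] by simp
      qed
      have "UNIV \<subseteq> (\<Union>x\<in>UNIV. U x)" using U(2) by blast
      then obtain C where "finite C" "UNIV \<subseteq> (\<Union>x\<in>C. U x)"
        by (rule compactE_image[OF compact_UNIV U(1)])
      then have "good UNIV" using good_finite[of C] by (simp add: top.extremum_unique)
      moreover have "measure \<mu> UNIV = 1"
        using prob_space.prob_space[OF borel_probsD(1)] borel_probsD(3) \<open>\<mu> \<in> borel_probs\<close> by metis
      ultimately show ?thesis using \<open>\<mu> \<in> borel_probs\<close> by (simp add: good_def)
    qed
    then have "\<bar>\<psi> \<mu> - integral\<^sup>L \<mu> f\<bar> \<le> 0" by (rule field_le_epsilon) simp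
    then show ?thesis by simp
  qed
  then show ?thesis using that by blast
qed

end

section \<open>Density and separation of measures\<close>

text \<open>On a compact metrizable space, the linear functionals below it are exactly the integrals
  against Borel probability measures: domination encodes positivity and total mass 1 at
  once.\<close>

definition sup_bcontfun :: "('a::topological_space \<Rightarrow>\<^sub>C real) \<Rightarrow> real" where
  "sup_bcontfun f = (SUP x. apply_bcontfun f x)"

lemma sup_bcontfun_upper: "apply_bcontfun f x \<le> sup_bcontfun f"
  unfolding sup_bcontfun_def
proof (rule cSUP_upper)
  show "bdd_above (range (apply_bcontfun f))"
    using norm_bounded[of f] by (intro bdd_aboveI2[of _ _ "norm f"]) (auto simp: abs_le_iff)
qed simp

lemma sup_bcontfun_least: "(\<And>x. apply_bcontfun f x \<le> c) \<Longrightarrow> sup_bcontfun f \<le> c"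
  unfolding sup_bcontfun_def by (rule cSUP_least) auto

lemma sublinear_sup_bcontfun: "sublinear sup_bcontfun"
proof (rule sublinearI)
  show "sup_bcontfun (f + g) \<le> sup_bcontfun f + sup_bcontfun g" for f g :: "'a \<Rightarrow>\<^sub>C real"
    by (rule sup_bcontfun_least) (simp add: add_mono sup_bcontfun_upper)
  show "sup_bcontfun (c *\<^sub>R f) \<le> c * sup_bcontfun f" if "0 < c" for c and f :: "'a \<Rightarrow>\<^sub>C real"
    using that by (intro sup_bcontfun_least) (simp add: sup_bcontfun_upper)
  show "sup_bcontfun (0 :: 'a \<Rightarrow>\<^sub>C real) = 0"
    by (simp add: sup_bcontfun_def)
qed

lemma integral_le_sup_bcontfun:
  assumes "\<mu> \<in> borel_probs"
  shows "integral\<^sup>L \<mu> (apply_bcontfun f) \<le> sup_bcontfun f"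
proof -
  interpret prob_space \<mu> by (rule borel_probsD(1)[OF assms])
  have "integral\<^sup>L \<mu> f \<le> integral\<^sup>L \<mu> (\<lambda>_. sup_bcontfun f)"
    by (intro integral_mono integrable_bcontfun assms integrable_const sup_bcontfun_upper)
  then show ?thesis by (simp add: prob_space)
qed

context compact_metrizable
begin

lemma continuous_in_bcontfun:
  fixes f :: "'a \<Rightarrow> real"
  assumes "continuous_on UNIV f"
  shows "f \<in> bcontfun"
proof -
  obtain b where "\<And>x. \<bar>f x\<bar> \<le> b" using continuous_bounded[OF assms] by metis
  then show ?thesis by (intro bcontfun_normI[OF assms]) auto
qed

text \<open>Domination at \<open>- f\<close> gives positivity, and domination at the constants 1 and
  -1 gives mass 1; then the Riesz theorem applies.\<close>

lemma functional_represented: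
  fixes l :: "('a \<Rightarrow>\<^sub>C real) \<Rightarrow> real"
  assumes lin: "linear l" and le: "l \<le> sup_bcontfun"
  obtains \<mu> where "\<mu> \<in> borel_probs" "\<And>f. l f = integral\<^sup>L \<mu> f"
proof -
  note apply_B = Bcontfun_inverse[OF continuous_in_bcontfun]
  interpret R: positive_functional space_type "\<lambda>f. l (Bcontfun f)"
  proof
    fix f g :: "'a \<Rightarrow> real" and c :: real
    assume f: "continuous_on UNIV f"
    show "l (Bcontfun (\<lambda>x. f x + g x)) = l (Bcontfun f) + l (Bcontfun g)" if "continuous_on UNIV g"
    proof -
      have "Bcontfun (\<lambda>x. f x + g x) = Bcontfun f + Bcontfun g"
        by (rule bcontfun_eqI) (simp add: apply_B f that continuous_intros)
      then show ?thesis using linear_add[OF lin] by simp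
    qed
    have "Bcontfun (\<lambda>x. c * f x) = c *\<^sub>R Bcontfun f"
      by (rule bcontfun_eqI) (simp add: apply_B f continuous_intros)
    then show "l (Bcontfun (\<lambda>x. c * f x)) = c * l (Bcontfun f)"
      using linear_scale[OF lin] by simp
    show "0 \<le> l (Bcontfun f)" if "\<And>x. 0 \<le> f x"
    proof -
      have "l (- Bcontfun f) \<le> sup_bcontfun (- Bcontfun f)"
        using le by (rule le_funD)
      also have "\<dots> \<le> 0"
        using that by (intro sup_bcontfun_least) (simp add: apply_B f)
      finally show ?thesis by (simp add: linear_neg[OF lin])
    qed
  next
    have "l (Bcontfun (\<lambda>_. 1)) \<le> 1" "l (- Bcontfun (\<lambda>_. 1)) \<le> - 1"
      by (rule order_trans[OF le_funD[OF le]], rule sup_bcontfun_least, simp add: apply_B)+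
    then show "l (Bcontfun (\<lambda>_. 1)) = 1" by (simp add: linear_neg[OF lin])
  qed
  show ?thesis
  proof (rule that)
    show "R.riesz \<in> borel_probs"
      by (simp add: borel_probs_def R.prob_space_riesz)
    show "l f = integral\<^sup>L R.riesz f" for f
      using R.integral_riesz[of "apply_bcontfun f"] by (simp add: apply_bcontfun_inverse)
  qed
qed

text \<open>The functional separating \<open>g\<close> from \<open>W\<close> is produced directly as a difference of two probability
  measures, by applying Hahn--Banach on \<open>C(X) \<times> C(X)\<close> to \<open>(f\<^sub>1, f\<^sub>2) \<mapsto> sup f\<^sub>1 + sup f\<^sub>2\<close>; its quotient
  at \<open>(g, -g)\<close> is twice the distance of \<open>g\<close> to \<open>W\<close>.\<close>

lemma dense_if_separates_probs:
  fixes W :: "('a \<Rightarrow>\<^sub>C real) set"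
  assumes W: "subspace W" and one: "const_bcontfun 1 \<in> W"
    and sep: "\<And>\<mu> \<nu>. \<mu> \<in> borel_probs \<Longrightarrow> \<nu> \<in> borel_probs \<Longrightarrow>
      (\<And>w. w \<in> W \<Longrightarrow> integral\<^sup>L \<mu> (apply_bcontfun w) = integral\<^sup>L \<nu> (apply_bcontfun w)) \<Longrightarrow> \<mu> = \<nu>"
  shows "closure W = UNIV"
proof (rule ccontr)
  assume "closure W \<noteq> UNIV"
  then obtain g where "g \<notin> closure W" by blast
  then obtain \<delta> where \<delta>: "0 < \<delta>" "\<And>w. w \<in> W \<Longrightarrow> \<delta> \<le> dist w g"
    unfolding closure_approachable by (auto simp: not_less)
  define p where "p y = sup_bcontfun (fst y) + sup_bcontfun (snd y)"
    for y :: "('a \<Rightarrow>\<^sub>C real) \<times> ('a \<Rightarrow>\<^sub>C real)"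
  \<comment> \<open>Vanishing on \<open>S\<close> says that the two component functionals of
    \<open>l\<close> agree on \<open>W\<close>.\<close>
  define S where "S = (\<lambda>w. (w, - w)) ` W"
  note sub = sublinear_sup_bcontfun
  have p: "sublinear p"
  proof (rule sublinearI)
    show "p (x + y) \<le> p x + p y" for x y
      using sublinear_add[OF sub, of "fst x" "fst y"] sublinear_add[OF sub, of "snd x" "snd y"]
      by (simp add: p_def)
    show "p (c *\<^sub>R x) \<le> c * p x" if "0 < c" for c x
      using that by (simp add: p_def sublinear_scaleR[OF sub] distrib_left)
  qed (simp add: p_def sublinear_0[OF sub])
  have S: "subspace S"
    unfolding S_def by (rule linear_subspace_image[OF _ W]) (rule linearI, auto)
  have nonneg: "0 \<le> p s" if "s \<in> S" for s
  proof -
    obtain w where "s = (w, - w)" using \<open>s \<in> S\<close> by (auto simp: S_def)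
    then show ?thesis using sublinear_minus[OF sub, of w] by (simp add: p_def)
  qed
  obtain l where l: "linear l" "l \<le> p" "\<And>s. s \<in> S \<Longrightarrow> l s = 0"
    "l (g, - g) = (INF s\<in>S. p ((g, - g) + s))"
  proof (rule exists_extreme_linear_vanishing_on_subspace[OF p S nonneg, where y = "(g, - g)"])
    fix l
    assume "linear l" "l \<le> p" "\<And>s. s \<in> S \<Longrightarrow> l s = 0" "l (g, - g) = (INF s\<in>S. p ((g, - g) + s))"
    then show thesis by (rule that)
  qed
  have "2 * \<delta> \<le> l (g, - g)"
    unfolding l(4)
  proof (rule cINF_greatest)
    show "S \<noteq> {}" using one by (auto simp: S_def)
    fix s assume "s \<in> S"
    then obtain w where w: "w \<in> W" "s = (w, - w)" by (auto simp: S_def)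
    let ?M = "sup_bcontfun (g + w)" and ?m = "- sup_bcontfun (- (g + w))"
    \<comment> \<open>The midrange of \<open>g + w\<close>: its sup-distance to \<open>g + w\<close>
      is half the oscillation, and constants belong to \<open>W\<close>.\<close>
    define c where "c = (?M + ?m) / 2"
    have "c *\<^sub>R const_bcontfun 1 - w \<in> W"
      by (intro subspace_diff subspace_scale W one w)
    then have "\<delta> \<le> dist (c *\<^sub>R const_bcontfun 1 - w) g" by (rule \<delta>(2))
    also have "\<dots> \<le> (?M - ?m) / 2"
    proof (rule dist_bound)
      fix x
      have "g x + w x \<le> ?M" "?m \<le> g x + w x"
        using sup_bcontfun_upper[of "g + w" x] sup_bcontfun_upper[of "- (g + w)" x] by auto
      then show "dist (apply_bcontfun (c *\<^sub>R const_bcontfun 1 - w) x) (g x) \<le> (?M - ?m) / 2"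
        by (simp add: dist_real_def c_def abs_le_iff field_simps const_bcontfun.rep_eq)
    qed
    finally show "2 * \<delta> \<le> p ((g, - g) + s)"
      by (simp add: p_def w add.commute)
  qed
  moreover have split: "l (f1, f2) = l (f1, 0) + l (0, f2)" for f1 f2
    using linear_add[OF l(1), of "(f1, 0)" "(0, f2)"] by simp
  have "linear (\<lambda>f. l (f, 0))" "linear (\<lambda>f. l (0, f))"
    using linear_compose[OF _ l(1), of "\<lambda>f. (f, 0)"] linear_compose[OF _ l(1), of "\<lambda>f. (0, f)"]
    by (simp_all add: o_def linear_iff)
  moreover have "(\<lambda>f. l (f, 0)) \<le> sup_bcontfun" "(\<lambda>f. l (0, f)) \<le> sup_bcontfun"
    using le_funD[OF l(2), of "(_, 0)"] le_funD[OF l(2), of "(0, _)"]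
    by (simp_all add: le_fun_def p_def sublinear_0[OF sub])
  ultimately obtain \<mu> \<nu> where \<mu>: "\<mu> \<in> borel_probs" "\<And>f. l (f, 0) = integral\<^sup>L \<mu> (apply_bcontfun f)"
    and \<nu>: "\<nu> \<in> borel_probs" "\<And>f. l (0, f) = integral\<^sup>L \<nu> (apply_bcontfun f)"
    using functional_represented by metis
  have diff: "l (f, - f) = integral\<^sup>L \<mu> f - integral\<^sup>L \<nu> f" for f
    using split[of f "- f"] \<mu>(2)[of f] \<nu>(2)[of "- f"] by simp
  have "\<mu> = \<nu>"
  proof (rule sep[OF \<mu>(1) \<nu>(1)])
    fix w assume "w \<in> W"
    then have "l (w, - w) = 0" by (intro l(3)) (simp add: S_def)
    then show "integral\<^sup>L \<mu> (apply_bcontfun w) = integral\<^sup>L \<nu> (apply_bcontfun w)"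
      by (simp add: diff)
  qed
  then have "l (g, - g) = 0" by (simp add: diff)
  with \<open>2 * \<delta> \<le> l (g, - g)\<close> \<delta>(1) show False by simp
qed

lemma bounded_linear_eq_0_if_dense:
  assumes L: "bounded_linear L" and dense: "closure (span G) = UNIV"
    and zero: "\<And>g. g \<in> G \<Longrightarrow> L g = 0"
  shows "L g = 0"
proof -
  have "closed {g. L g = 0}"
    using linear_continuous_on[OF L] by (intro closed_Collect_eq continuous_on_const) auto
  moreover have "span G \<subseteq> {g. L g = 0}"
    using zero linear_eq_0_on_span[OF bounded_linear.linear[OF L]] by blast
  ultimately have "closure (span G) \<subseteq> {g. L g = 0}" by (rule closure_minimal[rotated])
  then show ?thesis using dense by blast
qed

lemma bounded_linear_integral_bcontfun:
  assumes \<mu>: "\<mu> \<in> borel_probs"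
  shows "bounded_linear (\<lambda>f :: 'a \<Rightarrow>\<^sub>C real. integral\<^sup>L \<mu> f)"
proof -
  interpret prob_space \<mu> by (rule borel_probsD(1)[OF \<mu>])
  have "norm (integral\<^sup>L \<mu> f) \<le> norm f * 1" for f :: "'a \<Rightarrow>\<^sub>C real"
    using integral_bcontfun_near[OF \<mu>, of UNIV f 0 "norm f"] norm_bounded[of f] prob_space
    by (simp add: borel_probsD(3)[OF \<mu>])
  moreover have "linear (\<lambda>f :: 'a \<Rightarrow>\<^sub>C real. integral\<^sup>L \<mu> f)"
    by (rule integral_bcontfun_linear[OF \<mu>])
  ultimately show ?thesis
    unfolding bounded_linear_def bounded_linear_axioms_def linear_conv_bounded_linear by blast
qed

end

section \<open>Ergodic measures\<close>

lemma subspace_closure: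
  fixes S :: "'v::real_normed_vector set"
  assumes "subspace S"
  shows "subspace (closure S)"
proof (rule subspaceI)
  show "0 \<in> closure S" using closure_subset subspace_0[OF assms] by blast
  show "x + y \<in> closure S" if xy: "x \<in> closure S" "y \<in> closure S" for x y
  proof -
    obtain a where "\<forall>n. a n \<in> S" "a \<longlonglongrightarrow> x"
      using xy(1) unfolding closure_sequential by blast
    moreover obtain b where "\<forall>n. b n \<in> S" "b \<longlonglongrightarrow> y"
      using xy(2) unfolding closure_sequential by blast
    ultimately show ?thesis
      unfolding closure_sequential
      by (intro exI[of _ "\<lambda>n. a n + b n"]) (simp add: subspace_add[OF assms] tendsto_add)
  qed
  show "c *\<^sub>R x \<in> closure S" if x: "x \<in> closure S" for c x
  proof -
    obtain a where "\<forall>n. a n \<in> S" "a \<longlonglongrightarrow> x"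
      using x unfolding closure_sequential by blast
    then show ?thesis
      unfolding closure_sequential
      by (intro exI[of _ "\<lambda>n. c *\<^sub>R a n"]) (simp add: subspace_scale[OF assms] tendsto_scaleR)
  qed
qed

locale compact_metrizable_homeo = compact_metrizable space_type
    for space_type :: "'a::topological_space itself" +
  fixes T :: "'a \<Rightarrow> 'a"
  assumes homeo: "homeomorphic_map euclidean euclidean T"
begin

lemma bij_T: "bij T"
  using homeo by (auto simp: homeomorphic_map_def bij_def injective_quotient_map quotient_imp_surjective_map
      dest: quotient_imp_surjective_map)

lemma continuous_T: "continuous_on UNIV T"
  using homeomorphic_imp_continuous_map[OF homeo] by simp

lemma inv_T [simp]: "inv T (T x) = x" "T (inv T x) = x"
  using bij_T by (simp_all add: bij_is_inj bij_is_surj surj_f_inv_f)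

lemma continuous_inv_T: "continuous_on UNIV (inv T)"
proof -
  obtain g where g: "homeomorphic_maps euclidean euclidean T g"
    using homeo homeomorphic_map_maps by blast
  then have "g = inv T"
    by (intro ext) (metis UNIV_I homeomorphic_maps_def inv_T(2) topspace_euclidean)
  then show ?thesis using g by (simp add: homeomorphic_maps_def)
qed

lemma iterate_int_0 [simp]: "iterate_int T 0 = id"
  by (simp add: iterate_int_def id_def)

lemma iterate_int_nat [simp]: "iterate_int T (int k) = T ^^ k"
  by (simp add: iterate_int_def)

lemma iterate_int_add_1: "iterate_int T (n + 1) x = iterate_int T n (T x)"
proof (cases "0 \<le> n")
  case True
  then have "nat (n + 1) = Suc (nat n)" by simp
  with True show ?thesis by (simp add: iterate_int_def funpow_Suc_right del: funpow.simps)
next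
  case False
  then have "nat (- n) = Suc (nat (- (n + 1)))" by simp
  with False have "iterate_int T n (T x) = (inv T ^^ nat (- (n + 1))) (inv T (T x))"
    by (simp add: iterate_int_def funpow_Suc_right del: funpow.simps inv_T)
  with False show ?thesis
    \<comment> \<open>At \<open>n = - 1\<close> the definition switches from iterates of
      \<open>inv T\<close> to those of \<open>T\<close>.\<close>
    by (cases "n = - 1") (simp_all add: iterate_int_def)
qed

lemma continuous_iterate_int: "continuous_on UNIV (iterate_int T n)"
proof -
  have "continuous_on UNIV (S ^^ k)" if "continuous_on UNIV S" for S :: "'a \<Rightarrow> 'a" and k
  proof (induction k)
    case (Suc k)
    then show ?case
      using continuous_on_compose[of UNIV "S ^^ k" S] continuous_on_subset[OF that]
      by (simp add: o_def)
  qed (simp add: continuous_on_id')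
  then show ?thesis
    using continuous_T continuous_inv_T by (simp add: iterate_int_def)
qed

section \<open>Koopman operators and invariant integrals\<close>

definition koopman :: "int \<Rightarrow> ('a \<Rightarrow>\<^sub>C real) \<Rightarrow> 'a \<Rightarrow>\<^sub>C real" where
  "koopman n f = Bcontfun (\<lambda>x. apply_bcontfun f (iterate_int T n x))"

lemma apply_koopman: "apply_bcontfun (koopman n f) = (\<lambda>x. apply_bcontfun f (iterate_int T n x))"
proof -
  have "continuous_on UNIV (\<lambda>x. apply_bcontfun f (iterate_int T n x))"
    using continuous_on_compose[OF continuous_iterate_int[of n], of "apply_bcontfun f"] by (simp add: o_def)
  then show ?thesis
    unfolding koopman_def by (simp add: Bcontfun_inverse continuous_in_bcontfun)
qed

lemma koopman_linear: "linear (koopman n)"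
  by (rule linearI; rule bcontfun_eqI; simp add: apply_koopman)

lemma koopman_const [simp]: "koopman n (const_bcontfun c) = const_bcontfun c"
  by (rule bcontfun_eqI) (simp add: apply_koopman const_bcontfun.rep_eq)

lemma translates_eq: "translates T F = (\<Union>f\<in>F. range (\<lambda>n. koopman n f))"
proof -
  have "apply_bcontfun g = apply_bcontfun f \<circ> iterate_int T n \<longleftrightarrow> g = koopman n f" for f g n
    by (auto simp: fun_eq_iff apply_koopman intro: bcontfun_eqI)
  then show ?thesis by (auto simp: translates_def)
qed

lemma integral_koopman_add_1:
  assumes "\<mu> \<in> borel_probs"
  shows "integral\<^sup>L \<mu> (koopman (n + 1) f) = integral\<^sup>L (push T \<mu>) (koopman n f)"
  unfolding integral_push[OF continuous_T assms] by (simp add: apply_koopman iterate_int_add_1)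

lemma integral_koopman_invariant:
  assumes "\<mu> \<in> borel_probs" "push T \<mu> = \<mu>"
  shows "integral\<^sup>L \<mu> (koopman n f) = integral\<^sup>L \<mu> (apply_bcontfun f)"
proof (induction n rule: int_induct[where k = 0])
  case base
  show ?case by (simp add: apply_koopman)
next
  case (step1 i)
  then show ?case using integral_koopman_add_1[OF assms(1), of i f] assms(2) by simp
next
  case (step2 i)
  then show ?case using integral_koopman_add_1[OF assms(1), of "i - 1" f] assms(2) by simp
qed

section \<open>Ergodic measures, coboundaries and Birkhoff averages\<close>

lemma ergodic_probsD:
  assumes "\<mu> \<in> ergodic_probs T"
  shows "\<mu> \<in> borel_probs" "push T \<mu> = \<mu>"
    "\<And>A. A \<in> sets borel \<Longrightarrow> T -` A = A \<Longrightarrow> measure \<mu> A = 0 \<or> measure \<mu> A = 1"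
  using assms by (auto simp: ergodic_probs_def)

text \<open>Evaluate at a maximum point of \<open>u\<close>. This is the condition for passing to
  the quotient by coboundaries, and thereby the source of invariant measures.\<close>

lemma coboundary_sup_nonneg: "0 \<le> sup_bcontfun (u - koopman 1 u)"
proof -
  obtain y where y: "\<And>x. apply_bcontfun u x \<le> u y"
    using continuous_attains_sup[OF compact_UNIV _ continuous_on_apply_bcontfun[of UNIV u]] by auto
  have "0 \<le> apply_bcontfun (u - koopman 1 u) y"
    using y[of "iterate_int T 1 y"] by (simp add: apply_koopman)
  also have "\<dots> \<le> sup_bcontfun (u - koopman 1 u)" by (rule sup_bcontfun_upper)
  finally show ?thesis .
qed

text \<open>Conditioning an invariant measure on an invariant set keeps it invariant, so an extreme
  invariant functional is an ergodic measure.\<close>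

lemma ergodic_maximizer:
  fixes f :: "'a \<Rightarrow>\<^sub>C real"
  obtains \<mu> where "\<mu> \<in> ergodic_probs T"
    "\<And>e. 0 < e \<Longrightarrow> \<exists>u :: 'a \<Rightarrow>\<^sub>C real. \<forall>x. f x + u x - u (T x) \<le> integral\<^sup>L \<mu> f + e"
proof -
  \<comment> \<open>Among functionals represented by probability measures, vanishing on these
    coboundaries means \<open>T\<close>-invariance.\<close>
  define S where "S = range (\<lambda>u. u - koopman 1 u)"
  have kT: "apply_bcontfun (koopman 1 u) = (\<lambda>x. u (T x))" for u
    using iterate_int_add_1[of 0] by (simp add: apply_koopman)
  have S: "subspace S"
    unfolding S_def using koopman_linear[of 1]
    by (intro linear_subspace_image subspace_UNIV) (simp add: linear_iff algebra_simps)
  have nonneg: "0 \<le> sup_bcontfun s" if "s \<in> S" for s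
    using that coboundary_sup_nonneg by (auto simp: S_def)
  show ?thesis
  proof (rule exists_extreme_linear_vanishing_on_subspace[OF sublinear_sup_bcontfun S nonneg, where y = f])
    fix l
    assume lin: "linear l" and le: "l \<le> sup_bcontfun" and zero: "\<And>s. s \<in> S \<Longrightarrow> l s = 0"
      and max: "l f = (INF s\<in>S. sup_bcontfun (f + s))"
      and extreme: "\<And>l1 l2 t. linear l1 \<Longrightarrow> linear l2 \<Longrightarrow> l1 \<le> sup_bcontfun \<Longrightarrow> l2 \<le> sup_bcontfun \<Longrightarrow>
        (\<And>s. s \<in> S \<Longrightarrow> l1 s = 0) \<Longrightarrow> (\<And>s. s \<in> S \<Longrightarrow> l2 s = 0) \<Longrightarrow> 0 < t \<Longrightarrow> t < 1 \<Longrightarrow>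
        (\<And>x. l x = t * l1 x + (1 - t) * l2 x) \<Longrightarrow> l1 = l"
    obtain \<mu> where \<mu>: "\<mu> \<in> borel_probs" "\<And>f. l f = integral\<^sup>L \<mu> f"
      using functional_represented[OF lin le] by metis
    have inv: "push T \<mu> = \<mu>"
    proof (rule borel_probs_eqI[OF push_in_borel_probs[OF continuous_T \<mu>(1)] \<mu>(1)])
      fix g :: "'a \<Rightarrow>\<^sub>C real"
      have "l g = l (koopman 1 g)"
        using zero[of "g - koopman 1 g"] linear_diff[OF lin] by (simp add: S_def)
      then show "integral\<^sup>L (push T \<mu>) g = integral\<^sup>L \<mu> g"
        unfolding integral_push[OF continuous_T \<mu>(1)] by (simp add: \<mu>(2) kT)
    qed
    have functional: "linear (\<lambda>f :: 'a \<Rightarrow>\<^sub>C real. integral\<^sup>L \<nu> f)" "(\<lambda>f :: 'a \<Rightarrow>\<^sub>C real. integral\<^sup>L \<nu> f) \<le> sup_bcontfun"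
      "\<And>s. s \<in> S \<Longrightarrow> integral\<^sup>L \<nu> (apply_bcontfun s) = 0"
      if \<nu>: "\<nu> \<in> borel_probs" "push T \<nu> = \<nu>" for \<nu>
    proof -
      show lin': "linear (\<lambda>f :: 'a \<Rightarrow>\<^sub>C real. integral\<^sup>L \<nu> f)"
        by (rule integral_bcontfun_linear[OF \<nu>(1)])
      show "(\<lambda>f :: 'a \<Rightarrow>\<^sub>C real. integral\<^sup>L \<nu> f) \<le> sup_bcontfun"
        using integral_le_sup_bcontfun[OF \<nu>(1)] by (simp add: le_fun_def)
      show "integral\<^sup>L \<nu> (apply_bcontfun s) = 0" if s: "s \<in> S" for s
      proof -
        obtain u where "s = u - koopman 1 u" using s by (auto simp: S_def)
        then show ?thesis
          using linear_diff[OF lin', of u "koopman 1 u"] integral_koopman_invariant[OF \<nu>, of 1 u] by simp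
      qed
    qed
    have erg: "\<mu> \<in> ergodic_probs T"
      unfolding ergodic_probs_def
    proof (intro CollectI conjI ballI impI \<mu>(1) inv, rule ccontr)
      fix A assume A: "A \<in> sets borel" "T -` A = A"
        and "\<not> (measure \<mu> A = 0 \<or> measure \<mu> A = 1)"
      interpret prob_space \<mu> by (rule borel_probsD(1)[OF \<mu>(1)])
      have m: "0 < measure \<mu> A" "measure \<mu> A < 1"
        using \<open>\<not> (measure \<mu> A = 0 \<or> measure \<mu> A = 1)\<close> prob_le_1[of A] zero_less_measure_iff[of \<mu> A]
        by linarith+
      note mix = mixture_uniform_measure[OF \<mu>(1) A(1) m]
      let ?\<mu>1 = "uniform_measure \<mu> A" and ?\<mu>2 = "uniform_measure \<mu> (- A)"
      have A': "- A \<in> sets borel" "T -` (- A) = - A"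
        using A by (simp_all add: vimage_Compl)
      note probs = uniform_measure_in_borel_probs[OF \<mu>(1) m(1)]
        uniform_measure_in_borel_probs[OF \<mu>(1) mix(1)]
      have invs: "push T ?\<mu>1 = ?\<mu>1" "push T ?\<mu>2 = ?\<mu>2"
        using push_uniform_measure[OF continuous_T \<mu>(1) inv] A A' m mix(1) by auto
      have "(\<lambda>f :: 'a \<Rightarrow>\<^sub>C real. integral\<^sup>L ?\<mu>1 f) = l"
      proof (rule extreme[of _ "\<lambda>f. integral\<^sup>L ?\<mu>2 (apply_bcontfun f)" "measure \<mu> A"])
        show "l g = measure \<mu> A * integral\<^sup>L ?\<mu>1 g + (1 - measure \<mu> A) * integral\<^sup>L ?\<mu>2 g" for g
          using integral_mixture[OF probs, of "measure \<mu> A" g] mix(2) m by (simp add: \<mu>(2))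
      qed (use functional[OF probs(1) invs(1)] functional[OF probs(2) invs(2)] m in auto)
      then have "?\<mu>1 = \<mu>"
        by (intro borel_probs_eqI probs \<mu>(1)) (simp add: \<mu>(2)[symmetric], metis)
      moreover have "measure ?\<mu>1 A = 1"
        using m A borel_probsD(2)[OF \<mu>(1)] by (simp add: emeasure_eq_measure)
      ultimately show False using m by simp
    qed
    have "\<exists>u :: 'a \<Rightarrow>\<^sub>C real. \<forall>x. f x + u x - u (T x) \<le> integral\<^sup>L \<mu> f + e" if "0 < e" for e
    proof -
      \<comment> \<open>\<open>l f\<close> equals the infimum over coboundaries, so a near-minimiser
        supplies the required \<open>u\<close>.\<close>
      have "(INF s\<in>S. sup_bcontfun (f + s)) < l f + e"
        using max that by simp
      then have "\<not> (\<forall>s\<in>S. l f + e \<le> sup_bcontfun (f + s))"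
        using cINF_greatest[of S "l f + e" "\<lambda>s. sup_bcontfun (f + s)"] subspace_0[OF S]
        by (metis empty_iff not_le)
      then obtain s where s: "s \<in> S" "sup_bcontfun (f + s) < l f + e"
        by (auto simp: not_le)
      then obtain u where u: "s = u - koopman 1 u" by (auto simp: S_def)
      have "f x + u x - u (T x) \<le> integral\<^sup>L \<mu> f + e" for x
        using sup_bcontfun_upper[of "f + s" x] s(2) by (simp add: u \<mu>(2) kT)
      then show ?thesis by blast
    qed
    then show thesis using that[OF erg] by blast
  qed
qed

text \<open>The maximising ergodic measure integrates \<open>f\<close> to 0, so
  \<open>f \<le> e / 2 + u \<circ> T - u\<close> for some continuous \<open>u\<close>. Along an
  orbit the coboundary telescopes to a term bounded independently of \<open>N\<close>.\<close>

lemma birkhoff_sum_upper: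
  fixes f :: "'a \<Rightarrow>\<^sub>C real"
  assumes zero: "\<And>\<mu>. \<mu> \<in> ergodic_probs T \<Longrightarrow> integral\<^sup>L \<mu> f = 0" and "0 < e"
  shows "\<exists>N0. \<forall>N\<ge>N0. \<forall>x. (\<Sum>k<N. f ((T ^^ k) x)) \<le> e * real N"
proof -
  obtain \<mu> where \<mu>: "\<mu> \<in> ergodic_probs T"
    "\<And>e. 0 < e \<Longrightarrow> \<exists>u :: 'a \<Rightarrow>\<^sub>C real. \<forall>x. f x + u x - u (T x) \<le> integral\<^sup>L \<mu> f + e"
    by (rule ergodic_maximizer[of f]) (rule that)
  obtain u :: "'a \<Rightarrow>\<^sub>C real" where u: "\<And>x. f x + u x - u (T x) \<le> e / 2"
    using \<mu>(2)[of "e / 2"] \<open>0 < e\<close> zero[OF \<mu>(1)] by auto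
  have sum: "(\<Sum>k<N. f ((T ^^ k) x)) \<le> e / 2 * real N + u ((T ^^ N) x) - u x" for N x
  proof (induction N)
    case (Suc N)
    moreover have "e / 2 * real (Suc N) = e / 2 * real N + e / 2" by (simp add: field_simps)
    ultimately show ?case
      using u[of "(T ^^ N) x"] by (simp only: sum.lessThan_Suc funpow.simps o_apply)
  qed simp
  \<comment> \<open>Beyond this threshold the boundary term, at most \<open>2 * norm u\<close>, is
    at most \<open>e / 2 * real N\<close>.\<close>
  obtain N0 :: nat where N0: "4 * norm u / e \<le> real N0" using real_arch_simple by blast
  have "(\<Sum>k<N. f ((T ^^ k) x)) \<le> e * real N" if "N0 \<le> N" for N x
  proof -
    have "4 * norm u \<le> e * real N"
      using N0 that \<open>0 < e\<close> by (simp add: field_simps) (meson mult_left_mono of_nat_le_iff less_imp_le order_trans)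
    moreover have "u ((T ^^ N) x) - u x \<le> 2 * norm u"
      using norm_bounded[of u "(T ^^ N) x"] norm_bounded[of u x] by (simp add: abs_le_iff)
    ultimately show ?thesis using sum[of x N] by simp
  qed
  then show ?thesis by blast
qed

lemma birkhoff_average_uniform:
  fixes f :: "'a \<Rightarrow>\<^sub>C real"
  assumes zero: "\<And>\<mu>. \<mu> \<in> ergodic_probs T \<Longrightarrow> integral\<^sup>L \<mu> f = 0" and "0 < e"
  obtains N :: nat where "0 < N" "\<And>x. \<bar>\<Sum>k<N. f ((T ^^ k) x)\<bar> \<le> e * real N"
proof -
  obtain N1 where N1: "\<And>N x. N1 \<le> N \<Longrightarrow> (\<Sum>k<N. f ((T ^^ k) x)) \<le> e * real N"
    using birkhoff_sum_upper[of f, OF zero \<open>0 < e\<close>] by blast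
  have "integral\<^sup>L \<mu> (- f) = 0" if "\<mu> \<in> ergodic_probs T" for \<mu>
    using zero[OF that] by simp
  then obtain N2 where N2: "\<And>N x. N2 \<le> N \<Longrightarrow> (\<Sum>k<N. (- f) ((T ^^ k) x)) \<le> e * real N"
    using birkhoff_sum_upper[of "- f", OF _ \<open>0 < e\<close>] by blast
  show ?thesis
  proof (rule that[of "Suc (max N1 N2)"])
    show "\<bar>\<Sum>k<Suc (max N1 N2). f ((T ^^ k) x)\<bar> \<le> e * real (Suc (max N1 N2))" for x
      using N1[of "Suc (max N1 N2)" x] N2[of "Suc (max N1 N2)" x]
      by (simp only: uminus_bcontfun.rep_eq sum_negf abs_le_iff)
  qed simp
qed

end

section \<open>Multiplicity and the number of ergodic measures\<close>

lemma apply_bcontfun_sum: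
  fixes f :: "'i \<Rightarrow> 'a::topological_space \<Rightarrow>\<^sub>C 'b::real_normed_vector"
  shows "apply_bcontfun (sum f A) x = (\<Sum>i\<in>A. apply_bcontfun (f i) x)"
  by (induction A rule: infinite_finite_induct) auto

context compact_metrizable_homeo
begin

lemma iterate_int_vimage_suc: "iterate_int T (n + 1) -` Y = T -` (iterate_int T n -` Y)"
  by (auto simp: iterate_int_add_1)

text \<open>If \<open>Y\<close> is the positive part of a Hahn decomposition of \<open>\<mu> - \<nu>\<close>, the union of all its
  translates is again positive and now strictly invariant.\<close>

lemma ergodic_separating_set:
  assumes \<mu>: "\<mu> \<in> ergodic_probs T" and \<nu>: "\<nu> \<in> ergodic_probs T" and "\<mu> \<noteq> \<nu>"
  obtains Z where "Z \<in> sets borel" "measure \<mu> Z = 1" "measure \<nu> Z = 0"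
proof -
  interpret M: prob_space \<mu> by (rule borel_probsD(1)[OF ergodic_probsD(1)[OF \<mu>]])
  interpret N: prob_space \<nu> by (rule borel_probsD(1)[OF ergodic_probsD(1)[OF \<nu>]])
  note [simp] = borel_probsD(2,3)[OF ergodic_probsD(1)[OF \<mu>]] borel_probsD(2,3)[OF ergodic_probsD(1)[OF \<nu>]]
  obtain Y where Y: "Y \<in> sets borel"
    and pos: "\<And>X. X \<in> sets borel \<Longrightarrow> X \<subseteq> Y \<Longrightarrow> emeasure \<nu> X \<le> emeasure \<mu> X"
    and neg: "\<And>X. X \<in> sets borel \<Longrightarrow> X \<inter> Y = {} \<Longrightarrow> emeasure \<mu> X \<le> emeasure \<nu> X"
    using finite_unsigned_Hahn_decomposition[OF M.finite_measure_axioms N.finite_measure_axioms] by auto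
  define P where "P n = iterate_int T n -` Y" for n
  have P_borel: "P n \<in> sets borel" for n
    unfolding P_def by (rule vimage_borel[OF continuous_iterate_int Y])
  have P_suc: "P (n + 1) = T -` P n" for n
    unfolding P_def by (rule iterate_int_vimage_suc)
  have vimage: "emeasure \<mu> (T -` X) = emeasure \<mu> X" "emeasure \<nu> (T -` X) = emeasure \<nu> X"
    if "X \<in> sets borel" for X
    using emeasure_push[OF continuous_T ergodic_probsD(1)[OF \<mu>] that] ergodic_probsD(2)[OF \<mu>]
      emeasure_push[OF continuous_T ergodic_probsD(1)[OF \<nu>] that] ergodic_probsD(2)[OF \<nu>] by simp_all
  \<comment> \<open>Both measures are invariant, so positivity passes from \<open>Y\<close> to each
    translate, forwards by pulling back along \<open>inv T\<close> and backwards along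
    \<open>T\<close>.\<close>
  have posP: "emeasure \<nu> X \<le> emeasure \<mu> X" if "X \<in> sets borel" "X \<subseteq> P n" for X n
    using that
  proof (induction n arbitrary: X rule: int_induct[where k = 0])
    case base
    then show ?case using pos by (simp add: P_def)
  next
    case (step1 i)
    have X: "T -` (inv T -` X) = X" by auto
    have "inv T -` X \<subseteq> P i"
    proof
      fix x assume "x \<in> inv T -` X"
      then have "inv T x \<in> T -` P i" using step1.prems(2) P_suc[of i] by auto
      then show "x \<in> P i" by simp
    qed
    moreover have "inv T -` X \<in> sets borel"
      by (rule vimage_borel[OF continuous_inv_T step1.prems(1)])
    ultimately have "emeasure \<nu> (inv T -` X) \<le> emeasure \<mu> (inv T -` X)"
      using step1.IH by blast
    then show ?case
      using vimage[OF \<open>inv T -` X \<in> sets borel\<close>] by (simp add: X)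
  next
    case (step2 i)
    have "T -` X \<subseteq> P i" using P_suc[of "i - 1"] step2.prems(2) by auto
    then have "emeasure \<nu> (T -` X) \<le> emeasure \<mu> (T -` X)"
      by (intro step2.IH vimage_borel[OF continuous_T step2.prems(1)])
    then show ?case by (simp add: vimage[OF step2.prems(1)])
  qed
  define Z where "Z = (\<Union>n. P n)"
  have Z_borel: "Z \<in> sets borel"
    unfolding Z_def using P_borel by (intro sets.countable_UN') auto
  have Z_inv: "T -` Z = Z"
  proof -
    have "T -` Z = (\<Union>n. P (n + 1))" by (simp add: Z_def vimage_UN P_suc)
    also have "\<dots> = (\<Union>n\<in>range (\<lambda>n. n + 1). P n)" by (simp only: image_image)
    also have "range (\<lambda>n :: int. n + 1) = UNIV" by (rule surjI[of _ "\<lambda>n. n - 1"]) simp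
    finally show ?thesis by (simp add: Z_def)
  qed
  have posZ: "emeasure \<nu> X \<le> emeasure \<mu> X" if X: "X \<in> sets borel" "X \<subseteq> Z" for X
  proof -
    \<comment> \<open>The translates overlap; disjoint pieces, each inside a single translate, allow
      their inequalities to be summed.\<close>
    define D where "D k = X \<inter> disjointed (\<lambda>k. P (from_nat k)) k" for k
    have D_borel: "D k \<in> sets borel" for k
      unfolding D_def using X(1) sets.range_disjointed_sets[of "\<lambda>k. P (from_nat k)" borel] P_borel
      by (intro sets.Int) auto
    have D_disj: "disjoint_family D"
      using disjoint_family_disjointed[of "\<lambda>k. P (from_nat k)"]
      by (auto simp: D_def disjoint_family_on_def)
    have "(\<Union>k. P (from_nat k)) = Z"
      unfolding Z_def by (metis (no_types) UN_extend_simps(10) surj_from_nat)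
    then have D_UN: "(\<Union>k. D k) = X"
      using UN_disjointed_eq[of "\<lambda>k. P (from_nat k)"] X(2) by (auto simp: D_def)
    have "emeasure \<nu> X = (\<Sum>k. emeasure \<nu> (D k))"
      using suminf_emeasure[of D \<nu>] D_borel D_disj D_UN by (simp add: image_subset_iff)
    also have "\<dots> \<le> (\<Sum>k. emeasure \<mu> (D k))"
    proof (intro suminf_le posP[OF D_borel])
      show "D k \<subseteq> P (from_nat k)" for k
        using disjointed_subset[of "\<lambda>k. P (from_nat k)" k] by (auto simp: D_def)
    qed auto
    also have "\<dots> = emeasure \<mu> X"
      using suminf_emeasure[of D \<mu>] D_borel D_disj D_UN by (simp add: image_subset_iff)
    finally show ?thesis .
  qed
  have pos': "measure \<nu> X \<le> measure \<mu> X" if "X \<in> sets borel" "X \<subseteq> Z" for X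
    using posZ[OF that] by (simp add: M.emeasure_eq_measure N.emeasure_eq_measure)
  have neg': "measure \<mu> X \<le> measure \<nu> X" if "X \<in> sets borel" "X \<inter> Y = {}" for X
    using neg[OF that] by (simp add: M.emeasure_eq_measure N.emeasure_eq_measure)
  have YZ: "Y \<subseteq> Z"
    unfolding Z_def P_def using UN_upper[of 0 UNIV "\<lambda>n. iterate_int T n -` Y"] by simp
  have "measure \<nu> Z < measure \<mu> Z"
  proof (rule ccontr)
    assume "\<not> measure \<nu> Z < measure \<mu> Z"
    \<comment> \<open>Inside \<open>Z\<close>, subtract positivity of \<open>Z - A\<close> from
      \<open>measure \<mu> Z \<le> measure \<nu> Z\<close>; outside \<open>Z\<close>, the set
      \<open>A - Z\<close> misses \<open>Y\<close> and is negative. Since both measures have mass 1,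
      the inequality for all sets forces equality.\<close>
    have le: "measure \<mu> A \<le> measure \<nu> A" if A: "A \<in> sets borel" for A
    proof -
      have "measure \<mu> Z = measure \<mu> (A \<inter> Z) + measure \<mu> (Z - A)"
        using A Z_borel by (subst M.finite_measure_Union[symmetric]) (auto intro: arg_cong[where f = "measure \<mu>"])
      moreover have "measure \<nu> Z = measure \<nu> (A \<inter> Z) + measure \<nu> (Z - A)"
        using A Z_borel by (subst N.finite_measure_Union[symmetric]) (auto intro: arg_cong[where f = "measure \<nu>"])
      moreover have "measure \<nu> (Z - A) \<le> measure \<mu> (Z - A)"
        using A Z_borel by (intro pos') auto
      ultimately have "measure \<mu> (A \<inter> Z) \<le> measure \<nu> (A \<inter> Z)"
        using \<open>\<not> measure \<nu> Z < measure \<mu> Z\<close> by linarith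
      moreover have "measure \<mu> (A - Z) \<le> measure \<nu> (A - Z)"
        using A Z_borel YZ by (intro neg') auto
      moreover have "measure \<mu> A = measure \<mu> (A \<inter> Z) + measure \<mu> (A - Z)"
        using A Z_borel by (subst M.finite_measure_Union[symmetric]) (auto intro: arg_cong[where f = "measure \<mu>"])
      moreover have "measure \<nu> A = measure \<nu> (A \<inter> Z) + measure \<nu> (A - Z)"
        using A Z_borel by (subst N.finite_measure_Union[symmetric]) (auto intro: arg_cong[where f = "measure \<nu>"])
      ultimately show ?thesis by linarith
    qed
    have "\<mu> = \<nu>"
    proof (rule measure_eqI)
      fix A assume "A \<in> sets \<mu>"
      then have A: "A \<in> sets borel" by simp
      have "measure \<mu> (UNIV - A) = 1 - measure \<mu> A" "measure \<nu> (UNIV - A) = 1 - measure \<nu> A"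
        using M.prob_compl[of A] N.prob_compl[of A] A by simp_all
      then have "measure \<mu> A = measure \<nu> A"
        using le[OF A] le[of "UNIV - A"] A by simp
      then show "emeasure \<mu> A = emeasure \<nu> A"
        by (simp add: M.emeasure_eq_measure N.emeasure_eq_measure)
    qed simp
    with \<open>\<mu> \<noteq> \<nu>\<close> show False by simp
  qed
  then have "measure \<mu> Z = 1" "measure \<nu> Z = 0"
    using ergodic_probsD(3)[OF \<mu> Z_borel Z_inv] ergodic_probsD(3)[OF \<nu> Z_borel Z_inv] by auto
  then show ?thesis using that Z_borel by blast
qed

text \<open>Intersecting the sets that separate \<open>\<mu>\<close> from each other member of
  \<open>E\<close> gives a Borel set of full \<open>\<mu>\<close>-measure that is null for all the
  others; on it the combination reduces to \<open>a \<mu>\<close>.\<close>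

lemma ergodic_linearly_independent:
  fixes a :: "'a measure \<Rightarrow> real"
  assumes E: "finite E" "E \<subseteq> ergodic_probs T"
    and zero: "\<And>g :: 'a \<Rightarrow>\<^sub>C real. (\<Sum>\<mu>\<in>E. a \<mu> * integral\<^sup>L \<mu> g) = 0"
    and "\<mu> \<in> E"
  shows "a \<mu> = 0"
proof -
  have "\<exists>Z. Z \<in> sets borel \<and> measure \<mu> Z = 1 \<and> measure \<nu> Z = 0" if "\<nu> \<in> E - {\<mu>}" for \<nu>
    using ergodic_separating_set[of \<mu> \<nu>] that E(2) \<open>\<mu> \<in> E\<close> by blast
  then obtain Z where Z: "\<And>\<nu>. \<nu> \<in> E - {\<mu>} \<Longrightarrow> Z \<nu> \<in> sets borel \<and> measure \<mu> (Z \<nu>) = 1 \<and> measure \<nu> (Z \<nu>) = 0"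
    by metis
  \<comment> \<open>A finite intersection, written as a complement so that the union bound applies
    to the exceptional sets; it is the whole space if \<open>E = {\<mu>}\<close>.\<close>
  define B where "B = UNIV - (\<Union>\<nu>\<in>E - {\<mu>}. UNIV - Z \<nu>)"
  have probs: "\<nu> \<in> borel_probs" if "\<nu> \<in> E" for \<nu>
    using that E(2) ergodic_probsD(1) by blast
  have B: "B \<in> sets borel"
    unfolding B_def using E(1) Z by (intro sets.Diff sets.finite_UN) auto
  have zero_B: "measure \<nu> B = 0" if "\<nu> \<in> E - {\<mu>}" for \<nu>
  proof -
    interpret N: prob_space \<nu> using borel_probsD(1)[OF probs] that by blast
    have "measure \<nu> B \<le> measure \<nu> (Z \<nu>)"
      using Z[OF that] borel_probsD(2)[OF probs[of \<nu>]] that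
      by (intro N.finite_measure_mono) (auto simp: B_def)
    then show ?thesis using Z[OF that] measure_nonneg[of \<nu> B] by simp
  qed
  have one_B: "measure \<mu> B = 1"
  proof -
    interpret M: prob_space \<mu> by (rule borel_probsD(1)[OF probs[OF \<open>\<mu> \<in> E\<close>]])
    note [simp] = borel_probsD(2,3)[OF probs[OF \<open>\<mu> \<in> E\<close>]]
    have "measure \<mu> (\<Union>\<nu>\<in>E - {\<mu>}. UNIV - Z \<nu>) \<le> (\<Sum>\<nu>\<in>E - {\<mu>}. measure \<mu> (UNIV - Z \<nu>))"
      using E(1) Z by (intro measure_UNION_le) auto
    also have "\<dots> = 0"
    proof (intro sum.neutral ballI)
      fix \<nu> assume "\<nu> \<in> E - {\<mu>}"
      then show "measure \<mu> (UNIV - Z \<nu>) = 0"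
        using M.prob_compl[of "Z \<nu>"] Z[of \<nu>] by simp
    qed
    finally have "measure \<mu> (\<Union>\<nu>\<in>E - {\<mu>}. UNIV - Z \<nu>) = 0"
      using measure_nonneg[of \<mu>] by (simp add: antisym)
    moreover have "(\<Union>\<nu>\<in>E - {\<mu>}. UNIV - Z \<nu>) \<in> sets borel"
      using E(1) Z by (intro sets.finite_UN) auto
    ultimately show ?thesis
      unfolding B_def using M.prob_compl[of "\<Union>\<nu>\<in>E - {\<mu>}. UNIV - Z \<nu>"] by simp
  qed
  have "0 = (\<Sum>\<nu>\<in>E. a \<nu> * measure \<nu> B)"
    using signed_combination_eq_0[OF E(1) probs zero B] by simp
  also have "\<dots> = a \<mu>"
    using E(1) \<open>\<mu> \<in> E\<close> zero_B one_B by (simp add: sum.remove[of E \<mu>])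
  finally show ?thesis by simp
qed

text \<open>With more ergodic measures than generators, a nontrivial combination of them kills every
  generator. Invariance extends this to the translates and density to all of \<open>C(X)\<close>,
  contradicting independence.\<close>

lemma ergodic_card_le:
  assumes F: "finite F" "closure (span (translates T F)) = UNIV"
  shows "finite (ergodic_probs T) \<and> card (ergodic_probs T) \<le> card F"
proof (rule ccontr)
  assume contr: "\<not> (finite (ergodic_probs T) \<and> card (ergodic_probs T) \<le> card F)"
  obtain E where E: "E \<subseteq> ergodic_probs T" "finite E" "card F < card E"
  proof (cases "finite (ergodic_probs T)")
    case True
    then show ?thesis using contr that[of "ergodic_probs T"] by auto
  next
    case False
    then obtain E where "E \<subseteq> ergodic_probs T" "finite E" "card E = Suc (card F)"
      using infinite_arbitrarily_large by metis
    then show ?thesis using that[of E] by simp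
  qed
  obtain a where a: "\<And>f. f \<in> F \<Longrightarrow> (\<Sum>\<mu>\<in>E. a \<mu> * integral\<^sup>L \<mu> (apply_bcontfun f)) = 0" "\<exists>\<mu>\<in>E. a \<mu> \<noteq> 0"
    using homogeneous_system_nontrivial_solution[OF F(1) E(2,3), of "\<lambda>f \<mu>. integral\<^sup>L \<mu> (apply_bcontfun f)"]
    by metis
  have "bounded_linear (\<lambda>g. \<Sum>\<mu>\<in>E. a \<mu> * integral\<^sup>L \<mu> (apply_bcontfun g))"
    using E(1) ergodic_probsD(1)
    by (intro bounded_linear_sum bounded_linear_const_mult bounded_linear_integral_bcontfun) blast
  then have "(\<Sum>\<mu>\<in>E. a \<mu> * integral\<^sup>L \<mu> (apply_bcontfun g)) = 0" for g
  proof (rule bounded_linear_eq_0_if_dense[OF _ F(2)])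
    fix h assume "h \<in> translates T F"
    then obtain f n where h: "f \<in> F" "h = koopman n f" by (auto simp: translates_eq)
    have "integral\<^sup>L \<mu> (apply_bcontfun h) = integral\<^sup>L \<mu> (apply_bcontfun f)" if "\<mu> \<in> E" for \<mu>
      using integral_koopman_invariant ergodic_probsD(1,2) E(1) that unfolding h(2) by blast
    then show "(\<Sum>\<mu>\<in>E. a \<mu> * integral\<^sup>L \<mu> (apply_bcontfun h)) = 0"
      using a(1)[OF h(1)] by simp
  qed
  then have "\<forall>\<mu>\<in>E. a \<mu> = 0"
    using ergodic_linearly_independent[OF E(2,1)] by blast
  with a(2) show False by blast
qed

section \<open>Generating sets and the multiplicity\<close>

lemma closure_span_eq_UNIV:
  fixes V :: "('a \<Rightarrow>\<^sub>C real) set"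
  assumes "closure (span G) = UNIV" "G \<subseteq> closure (span V)"
  shows "closure (span V) = UNIV"
proof -
  have "span G \<subseteq> closure (span V)"
    by (rule span_minimal[OF assms(2) subspace_closure[OF subspace_span]])
  then have "closure (span G) \<subseteq> closure (span V)"
    by (rule closure_minimal) simp
  then show ?thesis using assms(1) by blast
qed

lemma Mult_le: "finite F \<Longrightarrow> card F \<le> m \<Longrightarrow> closure (span (translates T F)) = UNIV \<Longrightarrow> Mult T \<le> enat m"
  unfolding Mult_def by (rule INF_lower2[of F]) (auto simp: ecard_def)

text \<open>The infimum is attained because \<open>enat\<close> is well-ordered; a finite bound
  excludes the empty family, whose infimum is infinite.\<close>

lemma Mult_le_enatD:
  assumes "Mult T \<le> enat m"
  obtains F where "closure (span (translates T F)) = UNIV" "ecard F = Mult T" "finite F" "card F \<le> m"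
proof -
  let ?A = "ecard ` {F. closure (span (translates T F)) = UNIV}"
  have "Inf ?A \<in> ?A"
  proof (cases "?A = {}")
    case True
    then have "Mult T = \<infinity>" unfolding Mult_def True by (simp add: top_enat_def)
    with assms show ?thesis by simp
  next
    case False
    then show ?thesis by (auto intro: wellorder_InfI)
  qed
  then obtain F where F: "closure (span (translates T F)) = UNIV" "Inf ?A = ecard F" by blast
  then have "ecard F = Mult T" by (simp add: Mult_def)
  moreover from this have "finite F" "card F \<le> m"
    using assms by (auto simp: ecard_def enat_ord_simps(1)[symmetric] simp del: enat_ord_simps(1) split: if_splits)
  ultimately show ?thesis using that F(1) by blast
qed

lemma ecard_ergodic_le:
  assumes "Mult T \<le> enat m"
  shows "ecard (ergodic_probs T) \<le> enat m"
proof -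
  obtain F where "closure (span (translates T F)) = UNIV" "finite F" "card F \<le> m"
    using Mult_le_enatD[OF assms] by metis
  then show ?thesis using ergodic_card_le[of F] by (auto simp: ecard_def)
qed

text \<open>With few ergodic measures, some combination \<open>\<Sum> a\<^sub>i f\<^sub>i - a\<^sub>d\<close> integrates to \<open>0\<close> against all of them.
  The shifts \<open>s a\<^sub>i\<close> are chosen so that it becomes \<open>\<Sum> a\<^sub>i (f\<^sub>i + s a\<^sub>i) - 1\<close>; its uniform averages then
  show that \<open>1\<close> lies in the closed span of the translates of the \<open>f\<^sub>i + s a\<^sub>i\<close>.\<close>

lemma absorb_constants:
  fixes f :: "nat \<Rightarrow> 'a \<Rightarrow>\<^sub>C real"
  assumes dense: "closure (span (insert (const_bcontfun 1) (translates T (f ` {..<d})))) = UNIV"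
    and card: "finite (ergodic_probs T)" "card (ergodic_probs T) \<le> d"
  shows "Mult T \<le> enat d"
proof -
  let ?one = "const_bcontfun 1 :: 'a \<Rightarrow>\<^sub>C real"
  \<comment> \<open>Index \<open>d\<close> stands for the constant function, entered with
    coefficient \<open>- 1\<close>: there are \<open>d + 1\<close> unknowns for at most
    \<open>d\<close> equations.\<close>
  obtain a where a: "\<And>\<mu>. \<mu> \<in> ergodic_probs T \<Longrightarrow>
      (\<Sum>j\<in>{..d}. a j * (if j < d then integral\<^sup>L \<mu> (f j) else - 1)) = 0" "\<exists>j\<in>{..d}. a j \<noteq> 0"
    using homogeneous_system_nontrivial_solution[OF card(1) finite_atMost[of d],
        of "\<lambda>\<mu> j. if j < d then integral\<^sup>L \<mu> (f j) else - 1"] card(2) by auto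
  define h where "h = (\<Sum>j<d. a j *\<^sub>R f j) - a d *\<^sub>R ?one"
  have int_h: "integral\<^sup>L \<mu> h = 0" if \<mu>: "\<mu> \<in> ergodic_probs T" for \<mu>
  proof -
    interpret prob_space \<mu> by (rule borel_probsD(1)[OF ergodic_probsD(1)[OF \<mu>]])
    let ?I = "\<lambda>g :: 'a \<Rightarrow>\<^sub>C real. integral\<^sup>L \<mu> g"
    have lin: "linear ?I" by (rule integral_bcontfun_linear[OF ergodic_probsD(1)[OF \<mu>]])
    have "?I ?one = 1" by (simp add: const_bcontfun.rep_eq prob_space)
    then have "?I h = (\<Sum>j<d. a j * ?I (f j)) - a d"
      unfolding h_def by (simp add: linear_diff[OF lin] linear_sum[OF lin] linear_scale[OF lin] del: minus_bcontfun.rep_eq)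
    also have "\<dots> = (\<Sum>j\<in>{..d}. a j * (if j < d then ?I (f j) else - 1))"
      by (simp add: lessThan_Suc_atMost[symmetric])
    finally show ?thesis using a(1)[OF \<mu>] by simp
  qed
  \<comment> \<open>Otherwise \<open>h\<close> is the nonzero constant \<open>- a d\<close>, whose
    Birkhoff averages cannot be small. This makes the denominator of \<open>s\<close>
    nonzero.\<close>
  have "\<exists>j<d. a j \<noteq> 0"
  proof (rule ccontr)
    assume *: "\<not> (\<exists>j<d. a j \<noteq> 0)"
    then have "a d \<noteq> 0" using a(2) by (auto simp: le_less)
    have "apply_bcontfun h x = - a d" for x
      using * by (simp add: h_def const_bcontfun.rep_eq)
    moreover obtain N :: nat where "0 < N" "\<And>x. \<bar>\<Sum>k<N. h ((T ^^ k) x)\<bar> \<le> \<bar>a d\<bar> / 2 * real N"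
      using birkhoff_average_uniform[of h "\<bar>a d\<bar> / 2"] int_h \<open>a d \<noteq> 0\<close> by auto
    ultimately have "real N * \<bar>a d\<bar> \<le> \<bar>a d\<bar> / 2 * real N" by (simp add: abs_mult)
    with \<open>0 < N\<close> \<open>a d \<noteq> 0\<close> show False by (simp add: field_simps)
  qed
  then have sq: "(\<Sum>j<d. (a j)\<^sup>2) \<noteq> 0" by (auto simp: sum_nonneg_eq_0_iff)
  \<comment> \<open>Chosen so that the added constants contribute
    \<open>s * (\<Sum>j<d. (a j)\<^sup>2) = 1 - a d\<close>, which turns the combination of the
    \<open>g j\<close> into \<open>h + 1\<close>.\<close>
  define s where "s = (1 - a d) / (\<Sum>j<d. (a j)\<^sup>2)"
  define g where "g j = f j + (s * a j) *\<^sub>R ?one" for j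
  let ?V = "closure (span (translates T (g ` {..<d})))"
  have V: "subspace ?V" by (rule subspace_closure[OF subspace_span])
  have k_in: "koopman n (g j) \<in> span (translates T (g ` {..<d}))" if "j < d" for n j
    using that by (intro span_base) (auto simp: translates_eq)
  have h_eq: "h = (\<Sum>j<d. a j *\<^sub>R g j) - ?one"
  proof (rule bcontfun_eqI)
    fix x
    have "(\<Sum>j<d. a j * (s * a j)) = s * (\<Sum>j<d. (a j)\<^sup>2)"
      by (simp add: sum_distrib_left power2_eq_square ac_simps)
    also have "\<dots> = 1 - a d" using sq by (simp add: s_def)
    finally show "apply_bcontfun h x = apply_bcontfun ((\<Sum>j<d. a j *\<^sub>R g j) - ?one) x"
      by (simp add: h_def g_def const_bcontfun.rep_eq scaleR_add_right sum.distrib apply_bcontfun_sum)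
  qed
  have one: "?one \<in> ?V"
    unfolding closure_approachable
  proof (intro allI impI)
    fix e :: real assume "0 < e"
    obtain N :: nat where N: "0 < N" "\<And>x. \<bar>\<Sum>k<N. h ((T ^^ k) x)\<bar> \<le> e / 2 * real N"
      using birkhoff_average_uniform[of h "e / 2"] int_h \<open>0 < e\<close> by auto
    \<comment> \<open>The average over \<open>N\<close> steps of \<open>h + 1\<close>, written
      through translates of the \<open>g j\<close>; it differs from 1 by the Birkhoff average of
      \<open>h\<close>.\<close>
    define y where "y = (1 / real N) *\<^sub>R (\<Sum>k<N. \<Sum>j<d. a j *\<^sub>R koopman (int k) (g j))"
    have "y \<in> span (translates T (g ` {..<d}))"
      unfolding y_def by (intro span_scale span_sum k_in) simp
    moreover have "dist y ?one \<le> e / 2"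
    proof (rule dist_bound)
      fix x
      have "(\<Sum>k<N. h ((T ^^ k) x)) = (\<Sum>k<N. (\<Sum>j<d. a j * g j ((T ^^ k) x)) - 1)"
        by (simp add: h_eq apply_bcontfun_sum const_bcontfun.rep_eq)
      also have "\<dots> = real N * apply_bcontfun y x - real N"
        using N(1) by (simp add: y_def apply_bcontfun_sum apply_koopman sum_subtractf)
      also have "\<dots> = real N * (y x - 1)" by (simp add: algebra_simps)
      finally have "\<bar>real N * (y x - 1)\<bar> \<le> e / 2 * real N"
        using N(2)[of x] by (simp only:)
      then have "\<bar>y x - 1\<bar> \<le> e / 2"
        using N(1) by (simp add: abs_mult)
      then show "dist (apply_bcontfun y x) (apply_bcontfun ?one x) \<le> e / 2"
        by (simp add: dist_real_def const_bcontfun.rep_eq)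
    qed
    ultimately show "\<exists>y\<in>span (translates T (g ` {..<d})). dist y ?one < e"
      using \<open>0 < e\<close> by (intro bexI[of _ y]) auto
  qed
  have "closure (span (translates T (g ` {..<d}))) = UNIV"
  proof (rule closure_span_eq_UNIV[OF dense], rule subsetI)
    fix w assume "w \<in> insert ?one (translates T (f ` {..<d}))"
    then consider "w = ?one" | j n where "j < d" "w = koopman n (f j)"
      by (auto simp: translates_eq)
    then show "w \<in> ?V"
    proof cases
      case 1
      then show ?thesis using one by simp
    next
      case 2
      \<comment> \<open>Constants are fixed by \<open>koopman\<close>, so once 1 is available every
        translate of \<open>f j\<close> is recovered.\<close>
      have "koopman n (f j) = koopman n (g j) - (s * a j) *\<^sub>R ?one"
        by (rule bcontfun_eqI) (simp add: g_def apply_koopman const_bcontfun.rep_eq)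
      moreover have "koopman n (g j) \<in> ?V"
        using k_in[OF 2(1)] closure_subset by blast
      ultimately show ?thesis
        using 2 one by (simp add: subspace_diff[OF V] subspace_scale[OF V])
    qed
  qed
  then show ?thesis
    using card_image_le[of "{..<d}" g] by (intro Mult_le) auto
qed

end

section \<open>Affine embeddings\<close>

lemma continuous_map_integral_weak_star:
  "continuous_map weak_star_topology euclideanreal
    (\<lambda>\<mu>. integral\<^sup>L \<mu> (apply_bcontfun (f :: 'a::topological_space \<Rightarrow>\<^sub>C real)))"
  using continuous_map_pullback[OF continuous_map_product_projection[of f UNIV "\<lambda>_. euclideanreal"], of borel_probs
      "\<lambda>\<mu> (f :: 'a \<Rightarrow>\<^sub>C real). integral\<^sup>L \<mu> (apply_bcontfun f)"]
  by (simp add: weak_star_topology_def o_def)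

context compact_metrizable_homeo
begin

lemma push_inv: "\<mu> \<in> borel_probs \<Longrightarrow> push T (push (inv T) \<mu>) = \<mu>"
proof (rule borel_probs_eqI)
  assume \<mu>: "\<mu> \<in> borel_probs"
  show "push T (push (inv T) \<mu>) \<in> borel_probs" "\<mu> \<in> borel_probs"
    using \<mu> continuous_T continuous_inv_T by (auto intro: push_in_borel_probs)
  fix g :: "'a \<Rightarrow>\<^sub>C real"
  have "integral\<^sup>L (push T (push (inv T) \<mu>)) g = integral\<^sup>L (push (inv T) \<mu>) (koopman 1 g)"
    using integral_koopman_add_1[OF push_in_borel_probs[OF continuous_inv_T \<mu>], of 0 g]
    by (simp add: apply_koopman)
  also have "\<dots> = integral\<^sup>L \<mu> (\<lambda>x. koopman 1 g (inv T x))"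
    by (rule integral_push[OF continuous_inv_T \<mu>])
  also have "\<dots> = integral\<^sup>L \<mu> g"
    using iterate_int_add_1[of 0] by (simp add: apply_koopman)
  finally show "integral\<^sup>L (push T (push (inv T) \<mu>)) g = integral\<^sup>L \<mu> g" .
qed

lemma affine_embedding_if_dense:
  assumes dense: "closure (span (translates T F)) = UNIV" and F: "finite F" "card F = d"
  shows "\<exists>\<phi>. affine_embedding T d \<phi>"
proof -
  obtain f where f: "bij_betw f {..<d} F"
    using ex_bij_betw_nat_finite[OF F(1)] F(2) by (auto simp: atLeast0LessThan)
  \<comment> \<open>A common bound for the generators; the summand 1 keeps it positive.\<close>
  define c where "c = 1 + (\<Sum>i<d. norm (f i))"
  have c: "0 < c" "norm (f i) \<le> c" if "i < d" for i
  proof -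
    have "norm (f i) \<le> (\<Sum>i<d. norm (f i))" using that by (intro member_le_sum) auto
    then show "norm (f i) \<le> c" by (simp add: c_def)
  qed (simp add: c_def add_pos_nonneg sum_nonneg)
  \<comment> \<open>The map \<open>r \<mapsto> (r + c) / (2 * c)\<close> carries
    \<open>[-c, c]\<close> onto \<open>[0, 1]\<close>. The value \<open>undefined\<close> beyond
    \<open>d\<close> matches the extensional points of \<open>cube_sequences\<close>.\<close>
  define \<phi> :: "'a measure \<Rightarrow> int \<Rightarrow> nat \<Rightarrow> real" where
    "\<phi> \<mu> n i = (if i < d then (integral\<^sup>L \<mu> (koopman n (f i)) + c) / (2 * c) else undefined)" for \<mu> n i
  have unit: "(integral\<^sup>L \<mu> (koopman n (f i)) + c) / (2 * c) \<in> {0..1}"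
    if "\<mu> \<in> borel_probs" "i < d" for \<mu> n i
  proof -
    have "measure \<mu> UNIV = 1"
      using prob_space.prob_space[OF borel_probsD(1)[OF that(1)]] borel_probsD(3)[OF that(1)] by simp
    moreover have "\<bar>koopman n (f i) y - 0\<bar> \<le> c" for y
      using norm_bounded[of "f i" "iterate_int T n y"] c(2)[OF that(2)] by (simp add: apply_koopman)
    ultimately have "\<bar>integral\<^sup>L \<mu> (koopman n (f i)) - 0\<bar> \<le> c"
      by (intro integral_bcontfun_near[OF that(1), of UNIV]) auto
    then show ?thesis using c(1)[OF that(2)] by (simp add: abs_le_iff field_simps)
  qed
  have "continuous_map weak_star_topology (cube_sequences d) \<phi>"
    unfolding cube_sequences_def continuous_map_componentwise_UNIV
  proof
    fix n
    have "continuous_map weak_star_topology (top_of_set {0..1}) (\<lambda>\<mu>. \<phi> \<mu> n i)" if "i < d" for i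
    proof -
      have "continuous_map euclideanreal euclideanreal (\<lambda>r. (r + c) / (2 * c))"
        using c(1)[OF that] by (auto intro!: continuous_intros)
      from continuous_map_compose[OF continuous_map_integral_weak_star[of "koopman n (f i)"] this]
      show ?thesis
        using that unit by (auto simp: continuous_map_in_subtopology \<phi>_def o_def topspace_weak_star_topology)
    qed
    moreover have "(\<lambda>\<mu>. \<phi> \<mu> n) \<in> topspace weak_star_topology \<rightarrow> extensional {..<d}"
      by (auto simp: \<phi>_def extensional_def)
    ultimately show "continuous_map weak_star_topology (product_topology (\<lambda>_. top_of_set {0..1}) {..<d}) (\<lambda>\<mu>. \<phi> \<mu> n)"
      by (simp add: continuous_map_componentwise image_subset_iff_funcset)
  qed
  moreover have "inj_on \<phi> borel_probs"
  proof (rule inj_onI)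
    fix \<mu> \<nu> :: "'a measure"
    assume probs: "\<mu> \<in> borel_probs" "\<nu> \<in> borel_probs" and eq: "\<phi> \<mu> = \<phi> \<nu>"
    have bl: "bounded_linear (\<lambda>g :: 'a \<Rightarrow>\<^sub>C real. integral\<^sup>L \<mu> g - integral\<^sup>L \<nu> g)"
      by (intro bounded_linear_sub bounded_linear_integral_bcontfun probs)
    have "integral\<^sup>L \<mu> (apply_bcontfun g) - integral\<^sup>L \<nu> (apply_bcontfun g) = 0" for g :: "'a \<Rightarrow>\<^sub>C real"
    proof (rule bounded_linear_eq_0_if_dense[OF bl dense])
      fix g assume "g \<in> translates T F"
      then obtain i n where i: "i < d" "g = koopman n (f i)"
        using f by (auto simp: translates_eq bij_betw_def)
      then show "integral\<^sup>L \<mu> (apply_bcontfun g) - integral\<^sup>L \<nu> (apply_bcontfun g) = 0"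
        using fun_cong[OF fun_cong[OF eq], of n i] c(1)[OF i(1)] by (simp add: \<phi>_def)
    qed
    then show "\<mu> = \<nu>" by (intro borel_probs_eqI probs) simp
  qed
  moreover have "\<phi> (mixture t \<mu> \<nu>) n i = t * \<phi> \<mu> n i + (1 - t) * \<phi> \<nu> n i"
    if "\<mu> \<in> borel_probs" "\<nu> \<in> borel_probs" "t \<in> {0..1}" "i < d" for \<mu> \<nu> t n i
  proof -
    have "(t * x + (1 - t) * y + c) / r = t * ((x + c) / r) + (1 - t) * ((y + c) / r)" for x y r :: real
      by (simp add: algebra_simps add_divide_distrib diff_divide_distrib)
    then show ?thesis
      using that by (simp add: \<phi>_def integral_mixture)
  qed
  moreover have "\<phi> (push T \<mu>) = shift (\<phi> \<mu>)" if "\<mu> \<in> borel_probs" for \<mu>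
    by (intro ext) (simp add: \<phi>_def shift_def integral_koopman_add_1[OF that])
  ultimately show ?thesis
    unfolding affine_embedding_def by blast
qed

text \<open>Equivariance carries the representation from time 0 to all times: shifting the sequence
  is pushing the measure, which is composing the integrand with \<open>T\<close>.\<close>

lemma affine_embedding_coordinates:
  assumes emb: "affine_embedding T d \<phi>"
  obtains f where "\<And>\<mu> n i. \<mu> \<in> borel_probs \<Longrightarrow> i < d \<Longrightarrow> \<phi> \<mu> n i = integral\<^sup>L \<mu> (koopman n (f i))"
proof -
  have cont: "continuous_map weak_star_topology (cube_sequences d) \<phi>"
    and affine: "\<And>\<mu> \<nu> t n i. \<mu> \<in> borel_probs \<Longrightarrow> \<nu> \<in> borel_probs \<Longrightarrow> 0 \<le> t \<Longrightarrow> t \<le> 1 \<Longrightarrow> i < d \<Longrightarrow>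
      \<phi> (mixture t \<mu> \<nu>) n i = t * \<phi> \<mu> n i + (1 - t) * \<phi> \<nu> n i"
    and equivariant: "\<And>\<mu>. \<mu> \<in> borel_probs \<Longrightarrow> \<phi> (push T \<mu>) = shift (\<phi> \<mu>)"
    using emb by (auto simp: affine_embedding_def)
  have "\<exists>f :: 'a \<Rightarrow>\<^sub>C real. \<forall>\<mu>\<in>borel_probs. \<phi> \<mu> 0 i = integral\<^sup>L \<mu> f" if i: "i < d" for i
  proof -
    have "continuous_map weak_star_topology euclideanreal (\<lambda>\<mu>. \<phi> \<mu> 0 i)"
      using cont i
      by (auto simp: cube_sequences_def continuous_map_componentwise_UNIV continuous_map_componentwise
          continuous_map_in_subtopology)
    then obtain f :: "'a \<Rightarrow>\<^sub>C real" where "\<And>\<mu>. \<mu> \<in> borel_probs \<Longrightarrow> \<phi> \<mu> 0 i = integral\<^sup>L \<mu> f"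
      using affine_continuous_represented[of "\<lambda>\<mu>. \<phi> \<mu> 0 i"] affine[OF _ _ _ _ i] by metis
    then show ?thesis by blast
  qed
  then obtain f where f: "\<And>\<mu> i. i < d \<Longrightarrow> \<mu> \<in> borel_probs \<Longrightarrow>
      \<phi> \<mu> 0 i = integral\<^sup>L \<mu> (apply_bcontfun (f i :: 'a \<Rightarrow>\<^sub>C real))"
    by metis
  have "\<phi> \<mu> n i = integral\<^sup>L \<mu> (koopman n (f i))" if "\<mu> \<in> borel_probs" "i < d" for \<mu> n i
    using that(1)
  proof (induction n arbitrary: \<mu> rule: int_induct[where k = 0])
    case base
    then show ?case using f[OF that(2)] by (simp add: apply_koopman)
  next
    case (step1 n)
    have "\<phi> \<mu> (n + 1) i = \<phi> (push T \<mu>) n i"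
      by (simp add: equivariant[OF step1.prems] shift_def)
    then show ?case
      using step1.IH[OF push_in_borel_probs[OF continuous_T step1.prems]]
      by (simp add: integral_koopman_add_1[OF step1.prems])
  next
    case (step2 n)
    \<comment> \<open>To go back in time, \<open>\<mu>\<close> must itself be an image under
      \<open>push T\<close>.\<close>
    let ?\<nu> = "push (inv T) \<mu>"
    have \<nu>: "?\<nu> \<in> borel_probs" by (rule push_in_borel_probs[OF continuous_inv_T step2.prems])
    have "\<phi> \<mu> (n - 1) i = \<phi> ?\<nu> n i"
      using equivariant[OF \<nu>] by (simp add: push_inv[OF step2.prems] shift_def)
    then show ?case
      using step2.IH[OF \<nu>] integral_koopman_add_1[OF \<nu>, of "n - 1" "f i"]
      by (simp add: push_inv[OF step2.prems])
  qed
  then show ?thesis using that by blast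
qed

text \<open>Agreement on the translates of the coordinate functions means
  \<open>\<phi> \<mu> = \<phi> \<nu>\<close>, so injectivity separates. The constant is adjoined
  because the density criterion asks for it and no pair of probability measures can detect
  it.\<close>

lemma dense_if_affine_embedding:
  assumes emb: "affine_embedding T d \<phi>"
  obtains f :: "nat \<Rightarrow> 'a \<Rightarrow>\<^sub>C real" where
    "closure (span (insert (const_bcontfun 1) (translates T (f ` {..<d})))) = UNIV"
proof -
  obtain f where f: "\<And>\<mu> n i. \<mu> \<in> borel_probs \<Longrightarrow> i < d \<Longrightarrow> \<phi> \<mu> n i = integral\<^sup>L \<mu> (koopman n (f i))"
    by (rule affine_embedding_coordinates[OF emb]) (rule that)
  let ?G = "insert (const_bcontfun 1) (translates T (f ` {..<d}))"
  have "closure (span ?G) = UNIV"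
  proof (rule dense_if_separates_probs)
    show "const_bcontfun 1 \<in> span ?G" by (intro span_base) simp
    fix \<mu> \<nu> :: "'a measure"
    assume probs: "\<mu> \<in> borel_probs" "\<nu> \<in> borel_probs"
      and eq: "\<And>w. w \<in> span ?G \<Longrightarrow> integral\<^sup>L \<mu> (apply_bcontfun w) = integral\<^sup>L \<nu> (apply_bcontfun w)"
    \<comment> \<open>At indices outside \<open>{..<d}\<close> both images take the value
      \<open>undefined\<close>, so agreement below \<open>d\<close> gives full equality.\<close>
    have ext: "\<phi> \<mu> n \<in> extensional {..<d}" if "\<mu> \<in> borel_probs" for \<mu> n
    proof -
      have "\<phi> \<mu> \<in> topspace (cube_sequences d)"
        using emb that
        by (auto simp: affine_embedding_def continuous_map_def topspace_weak_star_topology)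
      then show ?thesis by (auto simp: cube_sequences_def PiE_iff)
    qed
    have "\<phi> \<mu> n i = \<phi> \<nu> n i" for n i
    proof (cases "i < d")
      case True
      then have "koopman n (f i) \<in> span ?G"
        by (intro span_base) (auto simp: translates_eq)
      then show ?thesis using f[OF probs(1) True] f[OF probs(2) True] eq by simp
    next
      case False
      then show ?thesis
        using extensional_arb[OF ext[OF probs(1)]] extensional_arb[OF ext[OF probs(2)]] by simp
    qed
    then have "\<phi> \<mu> = \<phi> \<nu>" by (simp add: fun_eq_iff)
    then show "\<mu> = \<nu>" using emb probs by (auto simp: affine_embedding_def inj_on_def)
  qed (rule subspace_span)
  then show ?thesis using that by blast
qed

text \<open>Adjoining 1 as a generator gives multiplicity at most \<open>d + 1\<close>, hence at
  most \<open>d + 1\<close> ergodic measures. If there are more than \<open>d\<close> of these, the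
  multiplicity also exceeds \<open>d\<close>, and both numbers are \<open>d + 1\<close>; otherwise
  the constant is absorbed.\<close>

lemma Mult_dichotomy_if_affine_embedding:
  assumes emb: "affine_embedding T d \<phi>"
  shows "(ecard (ergodic_probs T) \<le> enat d \<and> Mult T \<le> enat d) \<or>
    (ecard (ergodic_probs T) = enat (d + 1) \<and> Mult T = enat (d + 1))"
proof -
  let ?one = "const_bcontfun 1 :: 'a \<Rightarrow>\<^sub>C real"
  obtain f :: "nat \<Rightarrow> 'a \<Rightarrow>\<^sub>C real" where
    dense: "closure (span (insert ?one (translates T (f ` {..<d})))) = UNIV"
    by (rule dense_if_affine_embedding[OF emb])
  have "insert ?one (translates T (f ` {..<d})) \<subseteq> translates T (insert ?one (f ` {..<d}))"
    by (auto simp: translates_eq)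
  also have "\<dots> \<subseteq> closure (span (translates T (insert ?one (f ` {..<d}))))"
    using span_superset closure_subset by blast
  finally have "closure (span (translates T (insert ?one (f ` {..<d})))) = UNIV"
    by (rule closure_span_eq_UNIV[OF dense])
  moreover have "card (insert ?one (f ` {..<d})) \<le> d + 1"
    using card_image_le[of "{..<d}" f] by (simp add: card_insert_if)
  ultimately have Mult: "Mult T \<le> enat (d + 1)"
    by (intro Mult_le) auto
  show ?thesis
  proof (cases "ecard (ergodic_probs T) \<le> enat d")
    case True
    then have "finite (ergodic_probs T)" "card (ergodic_probs T) \<le> d"
      by (auto simp: ecard_def split: if_splits)
    then show ?thesis using absorb_constants[OF dense] True by blast
  next
    case False
    then have "\<not> Mult T \<le> enat d" using ecard_ergodic_le by blast
    then show ?thesis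
      using Mult ecard_ergodic_le[OF Mult] False
      by (cases "Mult T"; cases "ecard (ergodic_probs T)") auto
  qed
qed

end

theorem theorem3p3:
  fixes T :: "'a::topological_space \<Rightarrow> 'a" and d :: nat
  assumes "compact_space (euclidean :: 'a topology)"
    and "metrizable_space (euclidean :: 'a topology)"
    and "homeomorphic_map euclidean euclidean T"
  shows "(Mult T = enat d \<longrightarrow> (\<exists>\<phi>. affine_embedding T d \<phi>)) \<and>
    ((\<exists>\<phi>. affine_embedding T d \<phi>) \<longrightarrow>
      (ecard (ergodic_probs T) \<le> enat d \<and> Mult T \<le> enat d) \<or>
      (ecard (ergodic_probs T) = enat (d + 1) \<and> Mult T = enat (d + 1)))"
proof -
  interpret compact_metrizable_homeo "TYPE('a)" T
    using assms by unfold_locales (auto simp: compact_space_def)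
  have "\<exists>\<phi>. affine_embedding T d \<phi>" if "Mult T = enat d"
  proof -
    have "Mult T \<le> enat d" using that by simp
    then obtain F where F: "closure (span (translates T F)) = UNIV" "ecard F = Mult T" "finite F"
      by (rule Mult_le_enatD)
    then have "card F = d" using that by (simp add: ecard_def)
    with F show ?thesis by (intro affine_embedding_if_dense)
  qed
  then show ?thesis using Mult_dichotomy_if_affine_embedding by blast
qed

end
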